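(* Let $(\mathbf{u}^{m+1},p^{m+1},\phi^{m+1},\mu^{m+1})$ be any solution of the discrete scheme (S1)--(S4) (described in the context) for the data $(\mathbf{u}^m,\phi^m,\mu^m)$. Then the mass of the phase-field variable and of its regularization are conserved: $$\int_\Omega\phi^{m+1}=\int_\Omega\phi^m,\qquad \int_\Omega\Pi^h_1\phi^{m+1}=\int_\Omega\Pi^h_1\phi^m .$$ As a consequence, the mass of the mixture is also conserved: $$\int_\Omega\rho(\phi^{m+1})=\int_\Omega\rho(\phi^{m}),\qquad \int_\Omega\rho(\Pi^h_1\phi^{m+1})=\int_\Omega\rho(\Pi^h_1\phi^{m}).$$
   Context: **Constants and functions.** $\Omega\subset\mathbb{R}^d$ ($d\in\{2,3\}$) is a bounded polygonal (polyhedral) domain; $0<\rho_1<\rho_2$, $\lambda>0$, $\varepsilon>0$, $\Delta t>0$; $\eta\in C^0([-1,1])$ with $\eta\ge C>0$. For a real-valued function $v$, $v_\oplus=\max\{v,0\}$, $v_\ominus=-\min\{v,0\}$. Put $\rho_{\mathrm{avg}}=\frac{\rho_1+\rho_2}{2}$, $\rho_{\mathrm{dif}}=\frac{\rho_2-\rho_1}{2}$, $\rho(\phi)=\rho_{\mathrm{avg}}+\rho_{\mathrm{dif}}\phi$, $M(\phi)=(1-\phi^2)_\oplus$, and $f(\phi_1,\phi_0)=F_i'(\phi_1)+F_e'(\phi_0)$ with $F_i(\phi)=\phi^2+\frac14$, $F_e(\phi)=\frac14\phi^4-\frac32\phi^2$. $M^\uparrow(z)=M(z)$ if $z\le0$ and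 $M(0)$ if $z>0$; $M^\downarrow(z)=0$ if $z\le 0$ and $M(z)-M(0)$ if $z>0$. $\mathbf{D}\mathbf{u}=\frac12(\nabla\mathbf{u}+\nabla\mathbf{u}^t)$. $(\cdot,\cdot)$ is the $L^2(\Omega)$ scalar product (Frobenius product for tensors). $\delta_t v^{m+1}=(v^{m+1}-v^m)/\Delta t$. **Mesh.** $\mathcal{T}_h$ is a shape-regular simplicial mesh of $\overline\Omega$ such that for every interior edge (face) $e=K\cap L$ the line between the barycenters of $K$ and $L$ is orthogonal to $e$; $\mathcal{D}_e(\mathcal{T}_h)>0$ is the distance between these barycenters. $\mathcal{E}_h^{\mathrm i}$ is the set of interior edges (faces); each $e\in\mathcal{E}_h^{\mathrm i}$ has a fixed unit normal $\mathbf{n}_e$, and we write $e=K\cap L$ with $\mathbf{n}_e$ exterior to $K$ and pointing to $L$. On such $e$, $\{\!\{v\}\!\}=\frac{v_K+v_L}{2}$ and $[\![v]\!]=v_K-v_L$. **Spaces and projections.** $\mathbb{P}^{\mathrm{disc}}_k(\mathcal{T}_h)$ (resp. $\mathbb{P}^{\mathrm{cont}}_k(\mathcal{T}_h)$) is the space of discontinuous (resp. continuous) functions that are polynomials of degree at most $k$ on each $K\in\mathcal{T}_h$. $(\mathcal{U}_h,\mathcal{P}_h)$ is an inf-sup compatible (velocity, pressure) pair of finite-dimensional spaces with $\mathcal{U}_h\subset(C^0(\overline\Omega)\cap H^1_0(\Omega))^d$ and $\mathbb{P}^{\mathrm{disc}}_0(\mathcal{T}_h)\subset\mathcal{P}_h$.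 The mass-lumping product on $\mathbb{P}^{\mathrm{cont}}_1(\mathcal{T}_h)$ is $(\varphi,\psi)_h=\frac1{d+1}\sum_{K}|K|\sum_{j=1}^{d+1}\varphi(x_{j,K})\psi(x_{j,K})$, $x_{j,K}$ being the vertices of $K$. For $g\in L^1(\Omega)$: $\Pi_0g\in\mathbb{P}^{\mathrm{disc}}_0(\mathcal{T}_h)$ with $(\Pi_0g,\overline w)=(g,\overline w)$ for all $\overline w\in\mathbb{P}^{\mathrm{disc}}_0(\mathcal{T}_h)$; $\Pi_1g\in\mathbb{P}^{\mathrm{cont}}_1(\mathcal{T}_h)$ with $(\Pi_1g,\overline v)=(g,\overline v)$ for all $\overline v\in\mathbb{P}^{\mathrm{cont}}_1(\mathcal{T}_h)$ (applied componentwise to vector fields); $\Pi^h_1g\in\mathbb{P}^{\mathrm{cont}}_1(\mathcal{T}_h)$ with $(\Pi^h_1g,\overline v)_h=(g,\overline v)$ for all $\overline v\in\mathbb{P}^{\mathrm{cont}}_1(\mathcal{T}_h)$. **Forms** (differential operators are taken elementwise where needed): - $c_h(\phi,\mu,\overline{\mathbf u})=-\int_\Omega\nabla\cdot(\phi\overline{\mathbf u})\mu-\sum_{e\in\mathcal{E}_h^{\mathrm i}}\int_e(\overline{\mathbf u}\cdot\mathbf{n}_e)\{\!\{\phi\}\!\}[\![\mu]\!]$; - $a_h^{\mathrm{upw}}(\mathbf u;\phi,\overline\phi)=\sum_{e\in\mathcal{E}_h^{\mathrm i},e=K\cap L}\int_e\big((\mathbf u\cdot\mathbf n_e)_\oplus\phi_K-(\mathbf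 u\cdot\mathbf n_e)_\ominus\phi_L\big)[\![\overline\phi]\!]$; - $b_h^{\mathrm{upw}}(-\nabla^0_{\mathbf n}\mu;M(\phi),\overline\phi)=\sum_{e\in\mathcal{E}_h^{\mathrm i},e=K\cap L}\frac1{\mathcal{D}_e(\mathcal{T}_h)}\int_e\big([\![\Pi_0\mu]\!]_\oplus(M^\uparrow(\phi_K)+M^\downarrow(\phi_L))_\oplus-[\![\Pi_0\mu]\!]_\ominus(M^\uparrow(\phi_L)+M^\downarrow(\phi_K))_\oplus\big)[\![\overline\phi]\!]$, where $\nabla^0_{\mathbf n}\mu|_e=-[\![\Pi_0\mu]\!]/\mathcal{D}_e(\mathcal{T}_h)$; - $s_h^1(\mathbf u_1,\mathbf u_0,\phi_1,\phi_0,\mu,\overline{\mathbf u})=\frac12\Big\{\big(\tfrac{\rho(\phi_1)-\rho(\phi_0)}{\Delta t},\mathbf u_1\cdot\overline{\mathbf u}\big)-\big(\rho(\phi_0)\mathbf u_0-\rho_{\mathrm{dif}}M(\phi_0)\Pi_1(\nabla\mu),\nabla(\mathbf u_1\cdot\overline{\mathbf u})\big)\Big\}$; - $s_h^2(\mathbf u,\phi,\mu,\overline{\mathbf u})=-\frac12\sum_{e\in\mathcal{E}_h^{\mathrm i}}\int_e(\overline{\mathbf u}\cdot\mathbf n_e)\,\mathrm{sign}(\mathbf u\cdot\mathbf n_e)[\![\phi]\!][\![\mu]\!]$. **Scheme (one time step).** Given $\mathbf u^m\in\mathcal{U}_h$, $\phi^m\in\mathbb{P}^{\mathrm{disc}}_0(\mathcal{T}_h)$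 with values in $[-1,1]$, $\mu^m\in\mathbb{P}^{\mathrm{cont}}_1(\mathcal{T}_h)$, and $\mathbf J_h^m=\rho_{\mathrm{dif}}M(\Pi^h_1\phi^m)\Pi_1(\nabla\mu^m)$, find $\mathbf u^{m+1}\in\mathcal{U}_h$, $p^{m+1}\in\mathcal{P}_h$ with $\int_\Omega p^{m+1}=0$, $\phi^{m+1}\in\mathbb{P}^{\mathrm{disc}}_0(\mathcal{T}_h)$, $\mu^{m+1}\in\mathbb{P}^{\mathrm{cont}}_1(\mathcal{T}_h)$ such that, for all $\overline{\mathbf u}\in\mathcal{U}_h$, $\overline p\in\mathcal{P}_h$, $\overline\phi\in\mathbb{P}^{\mathrm{disc}}_0(\mathcal{T}_h)$, $\overline\mu\in\mathbb{P}^{\mathrm{cont}}_1(\mathcal{T}_h)$: (S1) $(\rho(\Pi^h_1\phi^m)\delta_t\mathbf u^{m+1},\overline{\mathbf u})+([(\rho(\Pi^h_1\phi^m)\mathbf u^m-\mathbf J^m_h)\cdot\nabla]\mathbf u^{m+1},\overline{\mathbf u})+2(\eta(\phi^m)\mathbf D\mathbf u^{m+1},\mathbf D\overline{\mathbf u})-(p^{m+1},\nabla\cdot\overline{\mathbf u})+c_h(\phi^{m+1},\Pi_0\mu^{m+1},\overline{\mathbf u})+s_h^1(\mathbf u^{m+1},\mathbf u^m,\Pi^h_1\phi^{m+1},\Pi^h_1\phi^m,\mu^m,\overline{\mathbf u})+s_h^2(\mathbf u^{m+1},\phi^{m+1},\Pi_0\mu^{m+1},\overline{\mathbf u})=0$;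 (S2) $(\nabla\cdot\mathbf u^{m+1},\overline p)=0$; (S3) $(\delta_t\phi^{m+1},\overline\phi)+a_h^{\mathrm{upw}}(\mathbf u^{m+1};\phi^{m+1},\overline\phi)+b_h^{\mathrm{upw}}(-\nabla^0_{\mathbf n}\mu^{m+1};M(\phi^{m+1}),\overline\phi)=0$; (S4) $\lambda\varepsilon(\nabla\Pi^h_1\phi^{m+1},\nabla\overline\mu)+\frac\lambda\varepsilon(f(\Pi^h_1\phi^{m+1},\Pi^h_1\phi^m),\overline\mu)-(\mu^{m+1},\overline\mu)_h=0$. *)

theory Defs
  imports "HOL-Analysis.Analysis"
begin

section \<open>Scalar functions of the model\<close>

definition pos_part :: "real \<Rightarrow> real" where
  "pos_part v = max v 0"

definition neg_part :: "real \<Rightarrow> real" where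
  "neg_part v = - min v 0"

definition rho_avg :: "real \<Rightarrow> real \<Rightarrow> real" where
  "rho_avg \<rho>1 \<rho>2 = (\<rho>1 + \<rho>2) / 2"

definition rho_dif :: "real \<Rightarrow> real \<Rightarrow> real" where
  "rho_dif \<rho>1 \<rho>2 = (\<rho>2 - \<rho>1) / 2"

definition mix_density :: "real \<Rightarrow> real \<Rightarrow> real \<Rightarrow> real" where
  "mix_density \<rho>1 \<rho>2 \<phi> = rho_avg \<rho>1 \<rho>2 + rho_dif \<rho>1 \<rho>2 * \<phi>"

definition mobility :: "real \<Rightarrow> real" where
  "mobility \<phi> = pos_part (1 - \<phi>\<^sup>2)"

definition mobility_up :: "real \<Rightarrow> real" where
  "mobility_up z = (if z \<le> 0 then mobility z else mobility 0)"

definition mobility_down :: "real \<Rightarrow> real" where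
  "mobility_down z = (if z \<le> 0 then 0 else mobility z - mobility 0)"

definition F_i :: "real \<Rightarrow> real" where
  "F_i \<phi> = \<phi>\<^sup>2 + 1/4"

definition F_e :: "real \<Rightarrow> real" where
  "F_e \<phi> = 1/4 * \<phi> ^ 4 - 3/2 * \<phi>\<^sup>2"

definition f_pot :: "real \<Rightarrow> real \<Rightarrow> real" where
  "f_pot \<phi>1 \<phi>0 = deriv F_i \<phi>1 + deriv F_e \<phi>0"


section \<open>Lebesgue and Sobolev notions\<close>

text \<open>Functions on \<open>\<Omega>\<close> are represented by total functions on \<open>real ^ 'd\<close>; values outside
  \<open>\<Omega>\<close> and on Lebesgue-null sets are irrelevant, whence the use of the complete measure
  \<^const>\<open>lebesgue\<close>.\<close>

text \<open>The inner product of \<open>real ^ 'd ^ 'd\<close> is the Frobenius product, so this single definition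
  covers scalars, vectors and tensors.\<close>

definition ip :: "(real ^ 'd) set \<Rightarrow> (real ^ 'd \<Rightarrow> 'b::real_inner) \<Rightarrow> (real ^ 'd \<Rightarrow> 'b) \<Rightarrow> real"
  where "ip \<Omega> f g = (LINT x:\<Omega>|lebesgue. f x \<bullet> g x)"

definition L2 :: "(real ^ 'd) set \<Rightarrow> (real ^ 'd \<Rightarrow> 'b::euclidean_space) set" where
  "L2 \<Omega> = {v. set_borel_measurable lebesgue \<Omega> v \<and>
              set_integrable lebesgue \<Omega> (\<lambda>x. (norm (v x))\<^sup>2)}"

definition partial_deriv :: "'d \<Rightarrow> (real ^ 'd \<Rightarrow> real) \<Rightarrow> real ^ 'd \<Rightarrow> real" where
  "partial_deriv i w x = frechet_derivative w (at x) (axis i 1)"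

primrec C_k :: "nat \<Rightarrow> (real ^ 'd \<Rightarrow> real) \<Rightarrow> bool" where
  "C_k 0 w \<longleftrightarrow> continuous_on UNIV w"
| "C_k (Suc k) w \<longleftrightarrow> w differentiable_on UNIV \<and> (\<forall>i. C_k k (partial_deriv i w))"

definition test_functions :: "(real ^ 'd) set \<Rightarrow> (real ^ 'd \<Rightarrow> real) set" where
  "test_functions G = {w. (\<forall>k. C_k k w) \<and> compact (closure {x. w x \<noteq> 0}) \<and>
                          closure {x. w x \<noteq> 0} \<subseteq> G}"

definition locally_integrable :: "(real ^ 'd) set \<Rightarrow> (real ^ 'd \<Rightarrow> 'b::euclidean_space) \<Rightarrow> bool"
  where "locally_integrable G v \<longleftrightarrow> (\<forall>C\<subseteq>G. compact C \<longrightarrow> set_integrable lebesgue C v)"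

definition is_weak_grad ::
  "(real ^ 'd) set \<Rightarrow> (real ^ 'd \<Rightarrow> real) \<Rightarrow> (real ^ 'd \<Rightarrow> real ^ 'd) \<Rightarrow> bool" where
  "is_weak_grad G v g \<longleftrightarrow> locally_integrable G v \<and> locally_integrable G g \<and>
     (\<forall>w\<in>test_functions G. \<forall>i.
        (LINT x:G|lebesgue. v x * partial_deriv i w x) = - (LINT x:G|lebesgue. (g x $ i) * w x))"

text \<open>\<open>H\<^sup>1\<^sub>0(\<Omega>)\<close>, the closure of the test functions in \<open>H\<^sup>1(\<Omega>)\<close>.\<close>

definition H10 :: "(real ^ 'd) set \<Rightarrow> (real ^ 'd \<Rightarrow> real) set" where
  "H10 \<Omega> = {v \<in> L2 \<Omega>. \<exists>g\<in>L2 \<Omega>. is_weak_grad \<Omega> v g \<and>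
     (\<exists>w. (\<forall>n::nat. w n \<in> test_functions \<Omega>) \<and>
        (\<lambda>n. LINT x:\<Omega>|lebesgue. (w n x - v x)\<^sup>2) \<longlonglongrightarrow> 0 \<and>
        (\<lambda>n. LINT x:\<Omega>|lebesgue. (norm ((\<chi> i. partial_deriv i (w n) x) - g x))\<^sup>2) \<longlonglongrightarrow> 0)}"


section \<open>Domain and mesh\<close>

text \<open>The condition \<^prop>\<open>interior (closure \<Omega>) = \<Omega>\<close> says that \<open>\<Omega>\<close> lies on one side of its
  boundary (no slits).\<close>

definition polyhedral_domain :: "(real ^ 'd) set \<Rightarrow> bool" where
  "polyhedral_domain \<Omega> \<longleftrightarrow> \<Omega> \<noteq> {} \<and> open \<Omega> \<and> connected \<Omega> \<and> bounded \<Omega> \<and>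
     interior (closure \<Omega>) = \<Omega> \<and>
     (\<exists>F. finite F \<and> (\<forall>Q\<in>F. polytope Q) \<and> closure \<Omega> = \<Union>F)"

definition vertices :: "(real ^ 'd) set \<Rightarrow> (real ^ 'd) set" where
  "vertices K = {x. x extreme_point_of K}"

definition barycenter :: "(real ^ 'd) set \<Rightarrow> real ^ 'd" where
  "barycenter K = (1 / real (card (vertices K))) *\<^sub>R (\<Sum>x\<in>vertices K. x)"

definition inradius :: "(real ^ 'd) set \<Rightarrow> real" where
  "inradius K = Sup {r. \<exists>c. cball c r \<subseteq> K}"

definition neighbours :: "(real ^ 'd) set set \<Rightarrow> (real ^ 'd) set \<Rightarrow> (real ^ 'd) set \<Rightarrow> bool" where
  "neighbours T K L \<longleftrightarrow> K \<in> T \<and> L \<in> T \<and> K \<noteq> L \<and> (K \<inter> L) facet_of K \<and> (K \<inter> L) facet_of L"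

definition interior_faces :: "(real ^ 'd) set set \<Rightarrow> (real ^ 'd) set set" where
  "interior_faces T = {e. \<exists>K L. neighbours T K L \<and> e = K \<inter> L}"

text \<open>\<open>\<sigma>\<close> is the shape-regularity constant.\<close>

definition admissible_mesh :: "(real ^ 'd) set \<Rightarrow> real \<Rightarrow> (real ^ 'd) set set \<Rightarrow> bool" where
  "admissible_mesh \<Omega> \<sigma> T \<longleftrightarrow> triangulation T \<and> \<Union>T = closure \<Omega> \<and>
     (\<forall>K\<in>T. int CARD('d) simplex K) \<and>
     (\<forall>K\<in>T. diameter K \<le> \<sigma> * (2 * inradius K)) \<and>
     (\<forall>K L. neighbours T K L \<longrightarrow>
        (\<forall>x\<in>K \<inter> L. \<forall>y\<in>K \<inter> L. (barycenter L - barycenter K) \<bullet> (x - y) = 0))"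

definition face_normals :: "(real ^ 'd) set set \<Rightarrow> ((real ^ 'd) set \<Rightarrow> real ^ 'd) \<Rightarrow> bool" where
  "face_normals T n \<longleftrightarrow>
     (\<forall>e\<in>interior_faces T. norm (n e) = 1 \<and> (\<forall>x\<in>e. \<forall>y\<in>e. n e \<bullet> (x - y) = 0))"

text \<open>Pairs \<open>(K, L)\<close> with \<open>e = K \<inter> L\<close> an interior face and \<open>n e\<close> exterior to \<open>K\<close> and pointing
  to \<open>L\<close>. Each interior face comes from exactly one such pair, so a sum over the interior faces
  \<open>e = K \<inter> L\<close> is a sum over this set.\<close>

definition oriented_faces ::
  "(real ^ 'd) set set \<Rightarrow> ((real ^ 'd) set \<Rightarrow> real ^ 'd) \<Rightarrow> ((real ^ 'd) set \<times> (real ^ 'd) set) set"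
  where
  "oriented_faces T n = {(K, L). neighbours T K L \<and>
     (\<forall>y\<in>K \<inter> L. (\<forall>x\<in>K. n (K \<inter> L) \<bullet> (x - y) \<le> 0) \<and> (\<forall>x\<in>L. n (K \<inter> L) \<bullet> (x - y) \<ge> 0))}"

text \<open>The integral over a flat face \<open>e\<close> with unit normal \<open>\<nu>\<close> with respect to the
  \<open>(d-1)\<close>-dimensional surface measure: the integrand is extended constantly in the direction
  \<open>\<nu>\<close> to the right prism of height one over \<open>e\<close>, whose volume measure is the product of the
  surface measure on \<open>e\<close> and the length measure on \<open>[0, 1]\<close>.\<close>

definition face_integral ::
  "real ^ 'd \<Rightarrow> (real ^ 'd) set \<Rightarrow> (real ^ 'd \<Rightarrow> real) \<Rightarrow> real" where
  "face_integral \<nu> e g =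
     (let z = (SOME z. z \<in> e) in
      LINT y:{x + t *\<^sub>R \<nu> | x t. x \<in> e \<and> 0 \<le> t \<and> t \<le> 1}|lebesgue.
        g (y - ((y - z) \<bullet> \<nu>) *\<^sub>R \<nu>))"

definition trace_from :: "(real ^ 'd) set \<Rightarrow> (real ^ 'd \<Rightarrow> real) \<Rightarrow> real ^ 'd \<Rightarrow> real" where
  "trace_from K v x = Lim (at x within interior K) v"

definition jump ::
  "(real ^ 'd) set \<Rightarrow> (real ^ 'd) set \<Rightarrow> (real ^ 'd \<Rightarrow> real) \<Rightarrow> real ^ 'd \<Rightarrow> real" where
  "jump K L v x = trace_from K v x - trace_from L v x"

definition average ::
  "(real ^ 'd) set \<Rightarrow> (real ^ 'd) set \<Rightarrow> (real ^ 'd \<Rightarrow> real) \<Rightarrow> real ^ 'd \<Rightarrow> real" where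
  "average K L v x = (trace_from K v x + trace_from L v x) / 2"


section \<open>Discrete spaces, projections and elementwise operators\<close>

definition polynomials :: "nat \<Rightarrow> (real ^ 'd \<Rightarrow> real) set" where
  "polynomials k =
     {p. \<exists>c :: ('d \<Rightarrow> nat) \<Rightarrow> real.
        p = (\<lambda>x. \<Sum>\<alpha>\<in>{\<alpha>. (\<Sum>i\<in>UNIV. \<alpha> i) \<le> k}. c \<alpha> * (\<Prod>i\<in>UNIV. (x $ i) ^ \<alpha> i))}"

text \<open>Elements of the discontinuous space are double-valued on the faces, so only the values in
  the interior of the elements are prescribed.\<close>

definition P_disc :: "nat \<Rightarrow> (real ^ 'd) set set \<Rightarrow> (real ^ 'd \<Rightarrow> real) set" where
  "P_disc k T = {v. \<forall>K\<in>T. \<exists>p\<in>polynomials k. \<forall>x\<in>interior K. v x = p x}"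

definition P_cont :: "nat \<Rightarrow> (real ^ 'd) set set \<Rightarrow> (real ^ 'd \<Rightarrow> real) set" where
  "P_cont k T = {v \<in> P_disc k T. continuous_on (\<Union>T) v}"

definition lumped_ip ::
  "(real ^ 'd) set set \<Rightarrow> (real ^ 'd \<Rightarrow> real) \<Rightarrow> (real ^ 'd \<Rightarrow> real) \<Rightarrow> real" where
  "lumped_ip T v w =
     1 / (real CARD('d) + 1) * (\<Sum>K\<in>T. measure lebesgue K * (\<Sum>x\<in>vertices K. v x * w x))"

text \<open>The projections are unique up to values outside \<open>\<Omega>\<close> and, for \<open>Proj0\<close>, on the faces; none
  of the forms below depends on those values.\<close>

definition Proj0 ::
  "(real ^ 'd) set \<Rightarrow> (real ^ 'd) set set \<Rightarrow> (real ^ 'd \<Rightarrow> real) \<Rightarrow> real ^ 'd \<Rightarrow> real" where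
  "Proj0 \<Omega> T g = (SOME q. q \<in> P_disc 0 T \<and> (\<forall>w\<in>P_disc 0 T. ip \<Omega> q w = ip \<Omega> g w))"

definition Proj1 ::
  "(real ^ 'd) set \<Rightarrow> (real ^ 'd) set set \<Rightarrow> (real ^ 'd \<Rightarrow> real) \<Rightarrow> real ^ 'd \<Rightarrow> real" where
  "Proj1 \<Omega> T g = (SOME q. q \<in> P_cont 1 T \<and> (\<forall>v\<in>P_cont 1 T. ip \<Omega> q v = ip \<Omega> g v))"

definition Proj1_vec ::
  "(real ^ 'd) set \<Rightarrow> (real ^ 'd) set set \<Rightarrow> (real ^ 'd \<Rightarrow> real ^ 'd) \<Rightarrow> real ^ 'd \<Rightarrow> real ^ 'd" where
  "Proj1_vec \<Omega> T g x = (\<chi> i. Proj1 \<Omega> T (\<lambda>y. g y $ i) x)"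

definition Proj1h ::
  "(real ^ 'd) set \<Rightarrow> (real ^ 'd) set set \<Rightarrow> (real ^ 'd \<Rightarrow> real) \<Rightarrow> real ^ 'd \<Rightarrow> real" where
  "Proj1h \<Omega> T g = (SOME q. q \<in> P_cont 1 T \<and> (\<forall>v\<in>P_cont 1 T. lumped_ip T q v = ip \<Omega> g v))"

text \<open>The elementwise gradient is the weak gradient on the union of the open elements. For
  functions that have an integrable weak gradient on \<open>\<Omega>\<close> the two agree almost everywhere.\<close>

definition grad_h ::
  "(real ^ 'd) set set \<Rightarrow> (real ^ 'd \<Rightarrow> real) \<Rightarrow> real ^ 'd \<Rightarrow> real ^ 'd" where
  "grad_h T v = (SOME g. is_weak_grad (\<Union>K\<in>T. interior K) v g)"

definition jac_h ::
  "(real ^ 'd) set set \<Rightarrow> (real ^ 'd \<Rightarrow> real ^ 'd) \<Rightarrow> real ^ 'd \<Rightarrow> real ^ 'd ^ 'd" where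
  "jac_h T u x = (\<chi> i. grad_h T (\<lambda>y. u y $ i) x)"

definition div_h :: "(real ^ 'd) set set \<Rightarrow> (real ^ 'd \<Rightarrow> real ^ 'd) \<Rightarrow> real ^ 'd \<Rightarrow> real" where
  "div_h T u x = trace (jac_h T u x)"

definition sym_grad_h ::
  "(real ^ 'd) set set \<Rightarrow> (real ^ 'd \<Rightarrow> real ^ 'd) \<Rightarrow> real ^ 'd \<Rightarrow> real ^ 'd ^ 'd" where
  "sym_grad_h T u x = (1/2) *\<^sub>R (jac_h T u x + transpose (jac_h T u x))"

text \<open>Linear space of functions which is finite-dimensional after identifying functions that
  agree almost everywhere on \<open>\<Omega>\<close>.\<close>

definition fin_dim_space :: "(real ^ 'd) set \<Rightarrow> (real ^ 'd \<Rightarrow> 'b::real_vector) set \<Rightarrow> bool" where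
  "fin_dim_space \<Omega> S \<longleftrightarrow> S \<noteq> {} \<and>
     (\<forall>u\<in>S. \<forall>v\<in>S. \<forall>a b. (\<lambda>x. a *\<^sub>R u x + b *\<^sub>R v x) \<in> S) \<and>
     (\<exists>B. finite B \<and> B \<subseteq> S \<and>
        (\<forall>v\<in>S. \<exists>c. AE x in lebesgue. x \<in> \<Omega> \<longrightarrow> v x = (\<Sum>b\<in>B. c b *\<^sub>R b x)))"

definition L2_norm :: "(real ^ 'd) set \<Rightarrow> (real ^ 'd \<Rightarrow> 'b::real_inner) \<Rightarrow> real" where
  "L2_norm \<Omega> v = sqrt (ip \<Omega> v v)"

definition H1_norm :: "(real ^ 'd) set \<Rightarrow> (real ^ 'd) set set \<Rightarrow> (real ^ 'd \<Rightarrow> real ^ 'd) \<Rightarrow> real" where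
  "H1_norm \<Omega> T u = sqrt (ip \<Omega> u u + ip \<Omega> (jac_h T u) (jac_h T u))"

text \<open>The inf-sup condition has to be restricted to pressures of zero mean, since \<open>Ph\<close> contains
  the constants. The supremum is taken in \<^typ>\<open>ereal\<close>.\<close>

definition inf_sup_compatible ::
  "(real ^ 'd) set \<Rightarrow> (real ^ 'd) set set \<Rightarrow> real \<Rightarrow> (real ^ 'd \<Rightarrow> real ^ 'd) set \<Rightarrow>
   (real ^ 'd \<Rightarrow> real) set \<Rightarrow> bool" where
  "inf_sup_compatible \<Omega> T \<beta> Uh Ph \<longleftrightarrow> 0 < \<beta> \<and>
     (\<forall>p\<in>Ph. (LINT x:\<Omega>|lebesgue. p x) = 0 \<and> L2_norm \<Omega> p \<noteq> 0 \<longrightarrow>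
        ereal \<beta> \<le> (SUP u\<in>{u \<in> Uh. H1_norm \<Omega> T u \<noteq> 0}.
           ereal (ip \<Omega> p (div_h T u) / (L2_norm \<Omega> p * H1_norm \<Omega> T u))))"

definition velocity_pressure_pair ::
  "(real ^ 'd) set \<Rightarrow> (real ^ 'd) set set \<Rightarrow> real \<Rightarrow> (real ^ 'd \<Rightarrow> real ^ 'd) set \<Rightarrow>
   (real ^ 'd \<Rightarrow> real) set \<Rightarrow> bool" where
  "velocity_pressure_pair \<Omega> T \<beta> Uh Ph \<longleftrightarrow>
     fin_dim_space \<Omega> Uh \<and> fin_dim_space \<Omega> Ph \<and>
     (\<forall>u\<in>Uh. continuous_on (closure \<Omega>) u \<and> (\<forall>i. (\<lambda>x. u x $ i) \<in> H10 \<Omega>)) \<and>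
     Ph \<subseteq> L2 \<Omega> \<and> P_disc 0 T \<subseteq> Ph \<and>
     inf_sup_compatible \<Omega> T \<beta> Uh Ph"


section \<open>Forms of the scheme\<close>

definition c_h ::
  "(real ^ 'd) set \<Rightarrow> (real ^ 'd) set set \<Rightarrow> ((real ^ 'd) set \<Rightarrow> real ^ 'd) \<Rightarrow>
   (real ^ 'd \<Rightarrow> real) \<Rightarrow> (real ^ 'd \<Rightarrow> real) \<Rightarrow> (real ^ 'd \<Rightarrow> real ^ 'd) \<Rightarrow> real" where
  "c_h \<Omega> T n \<phi> \<mu> ub =
     - (LINT x:\<Omega>|lebesgue. div_h T (\<lambda>y. \<phi> y *\<^sub>R ub y) x * \<mu> x)
     - (\<Sum>(K, L)\<in>oriented_faces T n. face_integral (n (K \<inter> L)) (K \<inter> L)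
          (\<lambda>x. (ub x \<bullet> n (K \<inter> L)) * average K L \<phi> x * jump K L \<mu> x))"

definition a_upw ::
  "(real ^ 'd) set set \<Rightarrow> ((real ^ 'd) set \<Rightarrow> real ^ 'd) \<Rightarrow>
   (real ^ 'd \<Rightarrow> real ^ 'd) \<Rightarrow> (real ^ 'd \<Rightarrow> real) \<Rightarrow> (real ^ 'd \<Rightarrow> real) \<Rightarrow> real" where
  "a_upw T n u \<phi> \<phi>b =
     (\<Sum>(K, L)\<in>oriented_faces T n. face_integral (n (K \<inter> L)) (K \<inter> L)
        (\<lambda>x. (pos_part (u x \<bullet> n (K \<inter> L)) * trace_from K \<phi> x
             - neg_part (u x \<bullet> n (K \<inter> L)) * trace_from L \<phi> x) * jump K L \<phi>b x))"

text \<open>\<open>b_upw \<Omega> T n \<mu> \<phi> \<phi>b\<close> stands for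
  \<open>b\<^sub>h\<^sup>u\<^sup>p\<^sup>w(-\<nabla>\<^sup>0\<^sub>n \<mu>; M(\<phi>), \<phi>b)\<close>.\<close>

definition b_upw ::
  "(real ^ 'd) set \<Rightarrow> (real ^ 'd) set set \<Rightarrow> ((real ^ 'd) set \<Rightarrow> real ^ 'd) \<Rightarrow>
   (real ^ 'd \<Rightarrow> real) \<Rightarrow> (real ^ 'd \<Rightarrow> real) \<Rightarrow> (real ^ 'd \<Rightarrow> real) \<Rightarrow> real" where
  "b_upw \<Omega> T n \<mu> \<phi> \<phi>b =
     (\<Sum>(K, L)\<in>oriented_faces T n. 1 / dist (barycenter K) (barycenter L) *
        face_integral (n (K \<inter> L)) (K \<inter> L)
        (\<lambda>x. (pos_part (jump K L (Proj0 \<Omega> T \<mu>) x) *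
                pos_part (mobility_up (trace_from K \<phi> x) + mobility_down (trace_from L \<phi> x))
             - neg_part (jump K L (Proj0 \<Omega> T \<mu>) x) *
                pos_part (mobility_up (trace_from L \<phi> x) + mobility_down (trace_from K \<phi> x)))
             * jump K L \<phi>b x))"

definition s1_h ::
  "(real ^ 'd) set \<Rightarrow> (real ^ 'd) set set \<Rightarrow> real \<Rightarrow> real \<Rightarrow> real \<Rightarrow>
   (real ^ 'd \<Rightarrow> real ^ 'd) \<Rightarrow> (real ^ 'd \<Rightarrow> real ^ 'd) \<Rightarrow>
   (real ^ 'd \<Rightarrow> real) \<Rightarrow> (real ^ 'd \<Rightarrow> real) \<Rightarrow> (real ^ 'd \<Rightarrow> real) \<Rightarrow>
   (real ^ 'd \<Rightarrow> real ^ 'd) \<Rightarrow> real" where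
  "s1_h \<Omega> T \<rho>1 \<rho>2 \<Delta>t u1 u0 \<phi>1 \<phi>0 \<mu> ub = 1/2 *
     (ip \<Omega> (\<lambda>x. (mix_density \<rho>1 \<rho>2 (\<phi>1 x) - mix_density \<rho>1 \<rho>2 (\<phi>0 x)) / \<Delta>t) (\<lambda>x. u1 x \<bullet> ub x)
      - ip \<Omega> (\<lambda>x. mix_density \<rho>1 \<rho>2 (\<phi>0 x) *\<^sub>R u0 x
                  - (rho_dif \<rho>1 \<rho>2 * mobility (\<phi>0 x)) *\<^sub>R Proj1_vec \<Omega> T (grad_h T \<mu>) x)
             (grad_h T (\<lambda>x. u1 x \<bullet> ub x)))"

definition s2_h ::
  "(real ^ 'd) set set \<Rightarrow> ((real ^ 'd) set \<Rightarrow> real ^ 'd) \<Rightarrow> (real ^ 'd \<Rightarrow> real ^ 'd) \<Rightarrow>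
   (real ^ 'd \<Rightarrow> real) \<Rightarrow> (real ^ 'd \<Rightarrow> real) \<Rightarrow> (real ^ 'd \<Rightarrow> real ^ 'd) \<Rightarrow> real" where
  "s2_h T n u \<phi> \<mu> ub = - (1/2) *
     (\<Sum>(K, L)\<in>oriented_faces T n. face_integral (n (K \<inter> L)) (K \<inter> L)
        (\<lambda>x. (ub x \<bullet> n (K \<inter> L)) * sgn (u x \<bullet> n (K \<inter> L)) * jump K L \<phi> x * jump K L \<mu> x))"

definition flux_J ::
  "(real ^ 'd) set \<Rightarrow> (real ^ 'd) set set \<Rightarrow> real \<Rightarrow> real \<Rightarrow>
   (real ^ 'd \<Rightarrow> real) \<Rightarrow> (real ^ 'd \<Rightarrow> real) \<Rightarrow> real ^ 'd \<Rightarrow> real ^ 'd" where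
  "flux_J \<Omega> T \<rho>1 \<rho>2 \<phi> \<mu> x =
     (rho_dif \<rho>1 \<rho>2 * mobility (Proj1h \<Omega> T \<phi> x)) *\<^sub>R Proj1_vec \<Omega> T (grad_h T \<mu>) x"


section \<open>The four equations of one time step\<close>

text \<open>The suffixes \<open>0\<close> and \<open>1\<close> denote the time levels \<open>m\<close> and \<open>m+1\<close>.\<close>

definition eq_S1 ::
  "(real ^ 'd) set \<Rightarrow> (real ^ 'd) set set \<Rightarrow> ((real ^ 'd) set \<Rightarrow> real ^ 'd) \<Rightarrow>
   (real ^ 'd \<Rightarrow> real ^ 'd) set \<Rightarrow> real \<Rightarrow> real \<Rightarrow> real \<Rightarrow> (real \<Rightarrow> real) \<Rightarrow>
   (real ^ 'd \<Rightarrow> real ^ 'd) \<Rightarrow> (real ^ 'd \<Rightarrow> real) \<Rightarrow> (real ^ 'd \<Rightarrow> real) \<Rightarrow>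
   (real ^ 'd \<Rightarrow> real ^ 'd) \<Rightarrow> (real ^ 'd \<Rightarrow> real) \<Rightarrow> (real ^ 'd \<Rightarrow> real) \<Rightarrow> (real ^ 'd \<Rightarrow> real) \<Rightarrow> bool"
  where
  "eq_S1 \<Omega> T n Uh \<rho>1 \<rho>2 \<Delta>t \<eta> u0 \<phi>0 \<mu>0 u1 p1 \<phi>1 \<mu>1 \<longleftrightarrow>
     (\<forall>ub\<in>Uh.
        ip \<Omega> (\<lambda>x. mix_density \<rho>1 \<rho>2 (Proj1h \<Omega> T \<phi>0 x) *\<^sub>R ((1 / \<Delta>t) *\<^sub>R (u1 x - u0 x))) ub
      + ip \<Omega> (\<lambda>x. jac_h T u1 x *v
                   (mix_density \<rho>1 \<rho>2 (Proj1h \<Omega> T \<phi>0 x) *\<^sub>R u0 x - flux_J \<Omega> T \<rho>1 \<rho>2 \<phi>0 \<mu>0 x)) ub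
      + 2 * ip \<Omega> (\<lambda>x. \<eta> (\<phi>0 x) *\<^sub>R sym_grad_h T u1 x) (sym_grad_h T ub)
      - ip \<Omega> p1 (div_h T ub)
      + c_h \<Omega> T n \<phi>1 (Proj0 \<Omega> T \<mu>1) ub
      + s1_h \<Omega> T \<rho>1 \<rho>2 \<Delta>t u1 u0 (Proj1h \<Omega> T \<phi>1) (Proj1h \<Omega> T \<phi>0) \<mu>0 ub
      + s2_h T n u1 \<phi>1 (Proj0 \<Omega> T \<mu>1) ub = 0)"

definition eq_S2 ::
  "(real ^ 'd) set \<Rightarrow> (real ^ 'd) set set \<Rightarrow> (real ^ 'd \<Rightarrow> real) set \<Rightarrow>
   (real ^ 'd \<Rightarrow> real ^ 'd) \<Rightarrow> bool" where
  "eq_S2 \<Omega> T Ph u1 \<longleftrightarrow> (\<forall>pb\<in>Ph. ip \<Omega> (div_h T u1) pb = 0)"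

definition eq_S3 ::
  "(real ^ 'd) set \<Rightarrow> (real ^ 'd) set set \<Rightarrow> ((real ^ 'd) set \<Rightarrow> real ^ 'd) \<Rightarrow> real \<Rightarrow>
   (real ^ 'd \<Rightarrow> real) \<Rightarrow> (real ^ 'd \<Rightarrow> real ^ 'd) \<Rightarrow> (real ^ 'd \<Rightarrow> real) \<Rightarrow>
   (real ^ 'd \<Rightarrow> real) \<Rightarrow> bool" where
  "eq_S3 \<Omega> T n \<Delta>t \<phi>0 u1 \<phi>1 \<mu>1 \<longleftrightarrow>
     (\<forall>\<phi>b\<in>P_disc 0 T.
        ip \<Omega> (\<lambda>x. (\<phi>1 x - \<phi>0 x) / \<Delta>t) \<phi>b + a_upw T n u1 \<phi>1 \<phi>b + b_upw \<Omega> T n \<mu>1 \<phi>1 \<phi>b = 0)"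

definition eq_S4 ::
  "(real ^ 'd) set \<Rightarrow> (real ^ 'd) set set \<Rightarrow> real \<Rightarrow> real \<Rightarrow>
   (real ^ 'd \<Rightarrow> real) \<Rightarrow> (real ^ 'd \<Rightarrow> real) \<Rightarrow> (real ^ 'd \<Rightarrow> real) \<Rightarrow> bool" where
  "eq_S4 \<Omega> T lam \<epsilon> \<phi>0 \<phi>1 \<mu>1 \<longleftrightarrow>
     (\<forall>\<mu>b\<in>P_cont 1 T.
        lam * \<epsilon> * ip \<Omega> (grad_h T (Proj1h \<Omega> T \<phi>1)) (grad_h T \<mu>b)
      + lam / \<epsilon> * ip \<Omega> (\<lambda>x. f_pot (Proj1h \<Omega> T \<phi>1 x) (Proj1h \<Omega> T \<phi>0 x)) \<mu>b
      - lumped_ip T \<mu>1 \<mu>b = 0)"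

end

theory Submission
  imports Defs
begin

text \<open>Testing the phase-field equation with the constant 1 kills both upwind forms, since they only see
  jumps of the test function; this conserves the integral of \<open>\<phi>\<close>. The lumped projection has the same
  integral as \<open>\<phi>\<close>: testing it with 1 gives the vertex quadrature of the projection, and vertex
  quadrature is exact on piecewise affine functions. Exactness amounts to the integral of each
  barycentric coordinate over a simplex \<open>K\<close> being \<open>|K| / (d + 1)\<close>, which is seen by integrating over
  superlevel sets: the set where a coordinate is at least \<open>s\<close> is a homothetic copy of \<open>K\<close> with ratio
  \<open>1 - s\<close>.\<close>

section \<open>Quadrature on a simplex\<close>

text \<open>The remaining vertices span a hyperplane by dimension count, and affine independence
  keeps \<open>v\<close> off it. Dividing the equation of that hyperplane by its value at
  \<open>v\<close> gives the coordinate function.\<close>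

lemma barycentric_coordinate:
  fixes C :: "'a::euclidean_space set"
  assumes ind: "\<not> affine_dependent C" and card: "card C = DIM('a) + 1" and v: "v \<in> C"
  obtains b c where "c + b \<bullet> v = 1" "\<And>w. w \<in> C - {v} \<Longrightarrow> c + b \<bullet> w = 0"
proof -
  have fin: "finite C" using ind by (rule aff_independent_finite)
  have "\<not> affine_dependent (C - {v})"
    using ind affine_independent_subset by blast
  then have "aff_dim (C - {v}) = int (card (C - {v})) - 1"
    by (simp add: affine_independent_iff_card)
  then have "aff_dim (C - {v}) = DIM('a) - 1"
    using card v fin by (simp add: of_nat_diff)
  then obtain a d where ad: "affine hull (C - {v}) = {x. a \<bullet> x = d}"
    using aff_dim_eq_hyperplane by blast
  have "v \<notin> affine hull (C - {v})"
    using ind v unfolding affine_dependent_def by blast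
  \<comment> \<open>\<open>D\<close> is the value at \<open>v\<close> of the function whose zero set
    is the opposite hyperplane; it is the normalising factor.\<close>
  moreover define D where "D = a \<bullet> v - d"
  ultimately have D: "D \<noteq> 0" "a \<bullet> v = D + d" using ad by auto
  show ?thesis
  proof
    show "- d / D + (a /\<^sub>R D) \<bullet> v = 1"
      using D by (simp add: field_simps)
    fix w assume "w \<in> C - {v}"
    then have "a \<bullet> w = d" using ad hull_inc[of w "C - {v}" affine] by auto
    then show "- d / D + (a /\<^sub>R D) \<bullet> w = 0"
      by (simp add: divide_inverse_commute)
  qed
qed

text \<open>A point of the hull is a convex combination of \<open>v\<close> and a point of the
  opposite face. The affine function is 1 at \<open>v\<close> and 0 on that face, so its value at
  the point is exactly the weight of \<open>v\<close>.\<close>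

lemma barycentric_decomposition:
  fixes C :: "'a::real_inner set"
  assumes v: "v \<in> C" and ne: "C - {v} \<noteq> {}"
    and one: "c + b \<bullet> v = 1" and zero: "\<And>w. w \<in> C - {v} \<Longrightarrow> c + b \<bullet> w = 0"
    and x: "x \<in> convex hull C"
  obtains z where "z \<in> convex hull C" "0 \<le> c + b \<bullet> x" "c + b \<bullet> x \<le> 1"
    "x = (c + b \<bullet> x) *\<^sub>R v + (1 - (c + b \<bullet> x)) *\<^sub>R z"
proof -
  have "x \<in> convex hull (insert v (C - {v}))" using x by (simp only: insert_Diff[OF v])
  then obtain u t z where uz: "u \<ge> 0" "t \<ge> 0" "u + t = 1" "z \<in> convex hull (C - {v})"
      "x = u *\<^sub>R v + t *\<^sub>R z"
    unfolding convex_hull_insert[OF ne] by blast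
  have "convex hull (C - {v}) \<subseteq> {z. b \<bullet> z = - c}"
    using zero by (intro hull_minimal convex_hyperplane) (auto simp: eq_neg_iff_add_eq_0 add.commute)
  then have z: "b \<bullet> z = - c" using uz by auto
  have bv: "b \<bullet> v = 1 - c" using one by simp
  have t: "t = 1 - u" using uz by simp
  have "c + b \<bullet> x = u"
    unfolding uz(5) t by (simp add: inner_add_right z bv algebra_simps)
  moreover have "z \<in> convex hull C"
    using uz(4) hull_mono[of "C - {v}" C] by auto
  ultimately show ?thesis using that uz t by auto
qed

text \<open>The homothety with centre \<open>v\<close> and ratio \<open>1 - s\<close> turns the
  value \<open>l\<close> of the coordinate into \<open>(1 - s) * l + s\<close>, so nonnegativity on
  the hull becomes being at least \<open>s\<close>. Conversely, a point whose weight at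
  \<open>v\<close> is at least \<open>s\<close> can be pulled back inside the hull.\<close>

lemma superlevel_eq_homothety:
  fixes C :: "'a::real_inner set"
  assumes v: "v \<in> C" and ne: "C - {v} \<noteq> {}"
    and one: "c + b \<bullet> v = 1" and zero: "\<And>w. w \<in> C - {v} \<Longrightarrow> c + b \<bullet> w = 0"
    and s: "0 \<le> s" "s < 1"
  shows "{x \<in> convex hull C. s \<le> c + b \<bullet> x} = (\<lambda>x. (1 - s) *\<^sub>R x + s *\<^sub>R v) ` (convex hull C)"
proof (intro equalityI subsetI)
  have vK: "v \<in> convex hull C" using v by (simp add: hull_inc)
  fix x assume x: "x \<in> {x \<in> convex hull C. s \<le> c + b \<bullet> x}"
  define u where "u = c + b \<bullet> x"
  obtain z where z: "z \<in> convex hull C" "0 \<le> u" "u \<le> 1" "x = u *\<^sub>R v + (1 - u) *\<^sub>R z"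
    using barycentric_decomposition[OF v ne one zero, of x] x unfolding u_def by blast
  have su: "s \<le> u" using x u_def by simp
  \<comment> \<open>The preimage comes from solving \<open>x = (1 - s) y + s v\<close> with
    \<open>x = u v + (1 - u) z\<close>; its coefficients sum to 1 and are nonnegative because
    \<open>s\<close> is at most \<open>u\<close>.\<close>
  let ?y = "((u - s) / (1 - s)) *\<^sub>R v + ((1 - u) / (1 - s)) *\<^sub>R z"
  have "?y \<in> convex hull C"
    using vK z su s by (intro convexD[OF convex_convex_hull]) (auto simp: field_simps)
  moreover have "x = (1 - s) *\<^sub>R ?y + s *\<^sub>R v"
  proof -
    have "(1 - s) *\<^sub>R ?y = (u - s) *\<^sub>R v + (1 - u) *\<^sub>R z"
      using s by (simp add: scaleR_right_distrib)
    then show ?thesis by (subst z(4)) (simp add: algebra_simps)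
  qed
  ultimately show "x \<in> (\<lambda>x. (1 - s) *\<^sub>R x + s *\<^sub>R v) ` (convex hull C)" by blast
next
  have vK: "v \<in> convex hull C" using v by (simp add: hull_inc)
  fix x assume "x \<in> (\<lambda>x. (1 - s) *\<^sub>R x + s *\<^sub>R v) ` (convex hull C)"
  then obtain y where y: "y \<in> convex hull C" "x = (1 - s) *\<^sub>R y + s *\<^sub>R v" by auto
  have "0 \<le> c + b \<bullet> y"
    using barycentric_decomposition[OF v ne one zero y(1)] by blast
  then have "0 \<le> (1 - s) * (c + b \<bullet> y)" using s by simp
  moreover have "c + b \<bullet> x = (1 - s) * (c + b \<bullet> y) + s * (c + b \<bullet> v)"
    unfolding y(2) by (simp add: inner_add_right algebra_simps)
  ultimately have "s \<le> c + b \<bullet> x" using one by simp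
  moreover have "x \<in> convex hull C"
    unfolding y(2) using y(1) vK s by (intro convexD[OF convex_convex_hull]) auto
  ultimately show "x \<in> {x \<in> convex hull C. s \<le> c + b \<bullet> x}" by simp
qed

text \<open>The integral is the measure of the region under the graph. Its section at height
  \<open>s\<close> is a copy of the simplex with volume scaled by \<open>(1 - s) ^ d\<close>, and
  integrating this over the unit interval gives the factor \<open>1 / (d + 1)\<close>.\<close>

lemma integral_barycentric_coordinate:
  fixes C :: "'a::euclidean_space set"
  assumes fin: "finite C" and v: "v \<in> C" and ne: "C - {v} \<noteq> {}"
    and one: "c + b \<bullet> v = 1" and zero: "\<And>w. w \<in> C - {v} \<Longrightarrow> c + b \<bullet> w = 0"
  shows "(LINT x:convex hull C|lebesgue. c + b \<bullet> x) =
         measure lebesgue (convex hull C) / (real DIM('a) + 1)"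
proof -
  define K where "K = convex hull C"
  define l where "l = (\<lambda>x. c + b \<bullet> x)"
  define V where "V = measure lebesgue K"
  have cK: "compact K" unfolding K_def using fin by (simp add: finite_imp_compact_convex_hull)
  have l01: "0 \<le> l x" "l x \<le> 1" if "x \<in> K" for x
    using barycentric_decomposition[OF v ne one zero, of x] that unfolding K_def l_def by blast+
  have K[measurable]: "K \<in> sets borel" using cK by (simp add: borel_compact)
  have lm[measurable]: "l \<in> borel_measurable borel" unfolding l_def by measurable
  have fK: "K \<in> lmeasurable" using cK by (rule lmeasurable_compact)
  \<comment> \<open>Fixing the point \<open>x\<close> in this region gives an interval of length
    \<open>l x\<close>; fixing the height gives a superlevel set of \<open>l\<close>.\<close>
  define G where "G = {p \<in> space (lborel \<Otimes>\<^sub>M lborel). fst p \<in> K \<and> 0 \<le> snd p \<and> snd p \<le> l (fst p)}"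
  have G[measurable]: "G \<in> sets (lborel \<Otimes>\<^sub>M lborel)"
    unfolding G_def by measurable
  have G_iff: "(x, s) \<in> G \<longleftrightarrow> x \<in> K \<and> 0 \<le> s \<and> s \<le> l x" for x s
    by (simp add: G_def space_pair_measure)
  have sect1: "(\<integral>\<^sup>+s. indicator G (x, s) \<partial>lborel) = ennreal (indicator K x * l x)" for x
  proof -
    have "(\<lambda>s. indicator G (x, s) :: ennreal) = indicator (if x \<in> K then {0..l x} else {})"
      by (auto simp: G_iff indicator_def)
    then show ?thesis using l01[of x] by (auto simp: indicator_def)
  qed
  \<comment> \<open>The height 1 is left out because the homothety would degenerate to ratio 0; a
    single height is null for the outer integral.\<close>
  have sect2: "(\<integral>\<^sup>+x. indicator G (x, s) \<partial>lborel) = ennreal ((1 - s) ^ DIM('a) * V) * indicator {0..1} s"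
    if "s \<noteq> 1" for s
  proof (cases "0 \<le> s \<and> s < 1")
    case True
    have eq: "{x \<in> K. s \<le> l x} = (\<lambda>x. (1 - s) *\<^sub>R x + s *\<^sub>R v) ` K"
      unfolding K_def l_def
      by (rule superlevel_eq_homothety[OF v ne one zero]) (use True in auto)
    have "(\<lambda>x. indicator G (x, s) :: ennreal) = indicator {x \<in> K. s \<le> l x}"
      using True by (auto simp: G_iff indicator_def)
    then have "(\<integral>\<^sup>+x. indicator G (x, s) \<partial>lborel) = emeasure lborel {x \<in> K. s \<le> l x}"
      by simp
    also have "\<dots> = emeasure lebesgue {x \<in> K. s \<le> l x}"
      by simp
    also have "\<dots> = \<bar>1 - s\<bar> ^ DIM('a) * emeasure lebesgue K"
      unfolding eq by (rule emeasure_lebesgue_affine)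
    also have "\<dots> = ennreal ((1 - s) ^ DIM('a) * V)"
      using True fK unfolding V_def
      by (simp add: emeasure_eq_measure2 ennreal_mult ennreal_power)
    finally show ?thesis using True by simp
  next
    case False
    then have "\<not> (x, s) \<in> G" for x
      using that l01[of x] unfolding G_iff by auto
    moreover have "s \<notin> {0..1}" using False that by auto
    ultimately show ?thesis by simp
  qed
  \<comment> \<open>The antiderivative is \<open>- (1 - s) ^ (d + 1) * V / (d + 1)\<close>.\<close>
  have "((\<lambda>s. (1 - s) ^ DIM('a) * V) has_integral
      - ((1 - 1) ^ Suc (DIM('a)) * V / real (Suc DIM('a))) -
      - ((1 - 0) ^ Suc (DIM('a)) * V / real (Suc DIM('a)))) {0..1::real}"
    by (rule fundamental_theorem_of_calculus)
      (auto intro!: derivative_eq_intros simp flip: has_real_derivative_iff_has_vector_derivative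
        simp del: power_Suc of_nat_Suc)
  then have int: "((\<lambda>s. (1 - s) ^ DIM('a) * V) has_integral V / (real DIM('a) + 1)) {0..1::real}"
    by (simp add: add.commute)
  have "(\<integral>\<^sup>+x. ennreal (indicator K x * l x) \<partial>lborel) = (\<integral>\<^sup>+x. \<integral>\<^sup>+s. indicator G (x, s) \<partial>lborel \<partial>lborel)"
    by (simp add: sect1)
  also have "\<dots> = (\<integral>\<^sup>+s. \<integral>\<^sup>+x. indicator G (x, s) \<partial>lborel \<partial>lborel)"
    by (rule lborel_pair.Fubini'[symmetric]) simp
  also have "\<dots> = (\<integral>\<^sup>+s. ennreal ((1 - s) ^ DIM('a) * V) * indicator {0..1} s \<partial>lborel)"
  proof (rule nn_integral_cong_AE)
    show "AE s in lborel. (\<integral>\<^sup>+x. indicator G (x, s) \<partial>lborel) =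
        ennreal ((1 - s) ^ DIM('a) * V) * indicator {0..1} s"
      using AE_lborel_singleton[of "1::real"] by eventually_elim (rule sect2)
  qed
  also have "\<dots> = ennreal (V / (real DIM('a) + 1))"
    using int by (intro nn_integral_has_integral_lebesgue') (auto simp: V_def)
  finally have nn: "(\<integral>\<^sup>+x. ennreal (indicator K x * l x) \<partial>lborel) = ennreal (V / (real DIM('a) + 1))" .
  \<comment> \<open>\<open>K\<close> and \<open>l\<close> are Borel, so the integral over the
    completed measure reduces to \<open>lborel\<close>, where the product argument was carried
    out.\<close>
  have "(LINT x:K|lebesgue. l x) = (LINT x|lborel. indicator K x * l x)"
    unfolding set_lebesgue_integral_def by (subst integral_completion) auto
  also have "\<dots> = enn2real (\<integral>\<^sup>+x. ennreal (indicator K x * l x) \<partial>lborel)"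
    by (rule integral_eq_nn_integral) (simp, rule AE_I2, use l01 in \<open>simp add: indicator_def\<close>)
  also have "\<dots> = V / (real DIM('a) + 1)"
    unfolding nn by (simp add: V_def)
  finally show ?thesis unfolding K_def l_def V_def .
qed

lemma set_integrable_compact:
  fixes f :: "'a::euclidean_space \<Rightarrow> real"
  assumes "compact K" "continuous_on K f"
  shows "set_integrable lebesgue K f"
  using borel_integrable_compact[OF assms]
  by (auto simp: set_integrable_def integrable_completion dest: borel_measurable_integrable)

text \<open>An affine function at a convex combination is the weighted mean of its values at the
  points. Applying this to the coordinate functions themselves shows that they are the
  weights.\<close>

lemma barycentric_representation:
  fixes C :: "'a::euclidean_space set"
  assumes fin: "finite C"
    and one: "\<And>v. v \<in> C \<Longrightarrow> c v + b v \<bullet> v = (1::real)"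
    and zero: "\<And>v w. v \<in> C \<Longrightarrow> w \<in> C - {v} \<Longrightarrow> c v + b v \<bullet> w = 0"
    and x: "x \<in> convex hull C"
  shows "a + p \<bullet> x = (\<Sum>v\<in>C. (a + p \<bullet> v) * (c v + b v \<bullet> x))"
proof -
  obtain u where u: "sum u C = 1" "(\<Sum>v\<in>C. u v *\<^sub>R v) = x"
    using x unfolding convex_hull_finite[OF fin] by auto
  have aff: "r + q \<bullet> x = (\<Sum>v\<in>C. u v * (r + q \<bullet> v))" for r q
    using u by (simp add: inner_sum_right algebra_simps sum.distrib flip: sum_distrib_left u(2))
  have "c w + b w \<bullet> x = u w" if w: "w \<in> C" for w
  proof -
    have "c w + b w \<bullet> x = (\<Sum>v\<in>C. if v = w then u v else 0)"
      unfolding aff by (rule sum.cong) (use w one zero in auto)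
    then show ?thesis using w fin by simp
  qed
  then show ?thesis unfolding aff[of a p] by (simp add: mult.commute)
qed

text \<open>Expand the affine function in barycentric coordinates, each of which integrates to the
  same share of the volume. Affine independence makes the generating points exactly the extreme
  points.\<close>

lemma integral_affine_simplex:
  fixes K :: "'a::euclidean_space set"
  assumes "int DIM('a) simplex K"
  shows "(LINT x:K|lebesgue. a + p \<bullet> x) =
         measure lebesgue K / (real DIM('a) + 1) * (\<Sum>v | v extreme_point_of K. a + p \<bullet> v)"
proof -
  obtain C where C: "\<not> affine_dependent C" "int (card C) = int DIM('a) + 1" "K = convex hull C"
    using assms unfolding simplex_def by blast
  then have card: "card C = DIM('a) + 1" and fin: "finite C"
    using aff_independent_finite by auto
  have ext: "{v. v extreme_point_of K} = C"
    using extreme_point_of_convex_hull_affine_independent[OF C(1)] C(3) by auto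
  have "\<exists>c b. c + b \<bullet> v = 1 \<and> (\<forall>w\<in>C - {v}. c + b \<bullet> w = 0)" if "v \<in> C" for v
    using barycentric_coordinate[OF C(1) card that] by metis
  then obtain c b where cb: "\<And>v. v \<in> C \<Longrightarrow> c v + b v \<bullet> v = 1"
      "\<And>v w. v \<in> C \<Longrightarrow> w \<in> C - {v} \<Longrightarrow> c v + b v \<bullet> w = 0"
    by metis
  \<comment> \<open>There are \<open>d + 1\<close>, hence at least two, vertices.\<close>
  have ne: "C - {v} \<noteq> {}" for v
    using card_mono[of "{v}" C] card by auto
  have cK: "compact K" unfolding C(3) using fin by (simp add: finite_imp_compact_convex_hull)
  have "(LINT x:K|lebesgue. a + p \<bullet> x) = (LINT x:K|lebesgue. (\<Sum>v\<in>C. (a + p \<bullet> v) * (c v + b v \<bullet> x)))"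
    using barycentric_representation[OF fin cb] cK
    by (intro set_lebesgue_integral_cong) (auto simp: C(3) lmeasurable_compact fmeasurableD)
  also have "\<dots> = (\<Sum>v\<in>C. LINT x:K|lebesgue. (a + p \<bullet> v) * (c v + b v \<bullet> x))"
    unfolding set_lebesgue_integral_def scaleR_sum_right
    by (intro Bochner_Integration.integral_sum set_integrable_compact[unfolded set_integrable_def]
        cK continuous_intros)
  also have "\<dots> = (\<Sum>v\<in>C. (a + p \<bullet> v) * (measure lebesgue K / (real DIM('a) + 1)))"
    using integral_barycentric_coordinate[OF fin _ ne cb] by (simp add: C(3))
  finally show ?thesis by (simp add: ext sum_distrib_left sum_divide_distrib mult.commute)
qed

section \<open>Riesz representation from point values\<close>

text \<open>The induction splits off one point \<open>j\<close>: the functions vanishing at \<open>pt j\<close> form the smaller problem,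
  and a function orthogonal to them spans the rest. This gives existence of the lumped projection
  without constructing a nodal basis.\<close>

lemma weighted_Riesz:
  fixes S :: "('a \<Rightarrow> real) set" and pt :: "'i \<Rightarrow> 'a"
  assumes "finite I" "S \<noteq> {}"
    and lin: "\<And>u v a b. u \<in> S \<Longrightarrow> v \<in> S \<Longrightarrow> (\<lambda>x. a * u x + b * v x) \<in> S"
    and pos: "\<And>i. i \<in> I \<Longrightarrow> 0 < w i"
    and l_lin: "\<And>u v a b. u \<in> S \<Longrightarrow> v \<in> S \<Longrightarrow> l (\<lambda>x. a * u x + b * v x) = a * l u + b * l v"
    and l_0: "\<And>v. v \<in> S \<Longrightarrow> (\<And>i. i \<in> I \<Longrightarrow> v (pt i) = 0) \<Longrightarrow> l v = 0"
  shows "\<exists>q\<in>S. \<forall>v\<in>S. (\<Sum>i\<in>I. w i * (q (pt i) * v (pt i))) = l v"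
  using assms
proof (induction I arbitrary: S l rule: finite_induct)
  \<comment> \<open>Without points, \<open>l_0\<close> forces \<open>l\<close> to vanish on
    \<open>S\<close>, so any member of \<open>S\<close> represents it.\<close>
  case empty
  then show ?case by auto
next
  case (insert j I)
  note lin = insert.prems(2) and pos = insert.prems(3)
  note l_lin = insert.prems(4) and l_0 = insert.prems(5)
  define B where "B J u v = (\<Sum>i\<in>J. w i * (u (pt i) * v (pt i)))" for J and u v :: "'a \<Rightarrow> real"
  have B_lin: "B J u (\<lambda>x. a * v x + b * v' x) = a * B J u v + b * B J u v'" for J u v v' a b
    by (simp add: B_def sum_distrib_left algebra_simps flip: sum.distrib)
  have B_lin': "B J (\<lambda>x. a * v x + b * v' x) u = a * B J v u + b * B J v' u" for J u v v' a b
    by (simp add: B_def sum_distrib_left algebra_simps flip: sum.distrib)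
  have B_insert: "B (insert j I) u v = w j * (u (pt j) * v (pt j)) + B I u v" for u v
    using insert.hyps by (simp add: B_def)
  define S' where "S' = {v \<in> S. v (pt j) = 0}"
  have S'_S: "v \<in> S" "v (pt j) = 0" if "v \<in> S'" for v using that by (auto simp: S'_def)
  have S'_lin: "(\<lambda>x. a * u x + b * v x) \<in> S'" if "u \<in> S'" "v \<in> S'" for u v a b
    using that lin by (simp add: S'_def)
  obtain s0 where s0: "s0 \<in> S" using insert.prems(1) by blast
  have "(\<lambda>x. 0 * s0 x + 0 * s0 x) \<in> S'"
    using lin[OF s0 s0, of 0 0] by (simp add: S'_def)
  then have S'_ne: "S' \<noteq> {}" by blast
  have "\<exists>q\<in>S'. \<forall>v\<in>S'. B I q v = l v"
    unfolding B_def
  proof (rule insert.IH[OF S'_ne S'_lin])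
    show "l (\<lambda>x. a * u x + b * v x) = a * l u + b * l v" if "u \<in> S'" "v \<in> S'" for u v a b
      using l_lin S'_S that by blast
    show "l v = 0" if "v \<in> S'" "\<And>i. i \<in> I \<Longrightarrow> v (pt i) = 0" for v
      using l_0[of v] S'_S that by auto
  qed (use pos in auto)
  then obtain q where q: "q \<in> S'" "\<And>v. v \<in> S' \<Longrightarrow> B I q v = l v" by blast
  show ?case
  proof (cases "\<forall>v\<in>S. v (pt j) = 0")
    case True
    then have "S = S'" by (auto simp: S'_def)
    then show ?thesis using q S'_S unfolding B_def[symmetric] B_insert
      by (intro bexI[of _ q]) auto
  next
    case False
    then obtain s where s: "s \<in> S" "s (pt j) \<noteq> 0" by blast
    \<comment> \<open>Second use of the induction hypothesis, now for the functional
      \<open>B I s\<close> in place of \<open>l\<close>; subtracting \<open>p\<close> from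
      \<open>s\<close> will give the orthogonal direction.\<close>
    have "\<exists>p\<in>S'. \<forall>v\<in>S'. B I p v = B I s v"
      unfolding B_def[of I]
    proof (rule insert.IH[OF S'_ne S'_lin])
      show "(\<Sum>i\<in>I. w i * (s (pt i) * (a * u (pt i) + b * v (pt i)))) =
          a * (\<Sum>i\<in>I. w i * (s (pt i) * u (pt i))) + b * (\<Sum>i\<in>I. w i * (s (pt i) * v (pt i)))"
        for u v a b using B_lin[of I s a u b v] by (simp only: B_def)
    qed (use pos in auto)
    then obtain p where p: "p \<in> S'" "\<And>v. v \<in> S' \<Longrightarrow> B I p v = B I s v" by blast
    \<comment> \<open>The coefficients are written out to match the shape of \<open>lin\<close>.
      Members of \<open>S'\<close> vanish at \<open>pt j\<close>, so the new term of the form does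
      not disturb the orthogonality of \<open>h\<close> to \<open>S'\<close>.\<close>
    define h where "h = (\<lambda>x. 1 * s x + (-1) * p x)"
    have hS: "h \<in> S" unfolding h_def using lin s p(1) S'_S by blast
    have hj: "h (pt j) \<noteq> 0" using s S'_S[OF p(1)] by (simp add: h_def)
    have h_orth: "B (insert j I) h v = 0" if "v \<in> S'" for v
      unfolding h_def B_lin' using p(2)[OF that] S'_S[OF that] by (simp add: B_insert)
    have "0 \<le> B I h h" unfolding B_def using pos by (intro sum_nonneg) (simp add: less_imp_le)
    moreover have "0 < w j * (h (pt j) * h (pt j))"
      using pos[of j] hj by (auto simp: zero_less_mult_iff linorder_neq_iff)
    \<comment> \<open>The form over \<open>I\<close> may degenerate, but the positive weight at
      \<open>j\<close> and the nonzero value of \<open>h\<close> there make this strict.\<close>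
    ultimately have hh: "0 < B (insert j I) h h" unfolding B_insert by linarith
    \<comment> \<open>Since \<open>q\<close> is orthogonal to \<open>h\<close>, this coefficient
      gives \<open>r\<close> the correct product with \<open>h\<close> and leaves its products with
      \<open>S'\<close> unchanged.\<close>
    define c where "c = l h / B (insert j I) h h"
    define r where "r = (\<lambda>x. 1 * q x + c * h x)"
    have "r \<in> S" unfolding r_def using lin hS q(1) S'_S by blast
    moreover have "B (insert j I) r v = l v" if v: "v \<in> S" for v
    proof -
      \<comment> \<open>Every \<open>v\<close> splits as a member of \<open>S'\<close> plus
        \<open>t\<close> times \<open>h\<close>, with \<open>t\<close> fixed by the value at
        \<open>pt j\<close>; checking \<open>r\<close> on both summands suffices.\<close>
      define t where "t = v (pt j) / h (pt j)"
      define v' where "v' = (\<lambda>x. 1 * v x + (- t) * h x)"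
      have v': "v' \<in> S'"
        unfolding S'_def v'_def using lin[OF v hS, of 1 "- t"] hj by (simp add: t_def)
      have v_eq: "v = (\<lambda>x. 1 * v' x + t * h x)" by (simp add: v'_def)
      have "B (insert j I) r v' = l v'"
        unfolding r_def B_lin' using q(2)[OF v'] h_orth[OF v'] S'_S[OF v'] by (simp add: B_insert)
      moreover have "B (insert j I) q h = 0"
        using h_orth[OF q(1)] by (simp add: B_def mult.commute)
      then have "B (insert j I) r h = l h"
        unfolding r_def B_lin' using hh by (simp add: c_def)
      ultimately show ?thesis
        using l_lin[OF S'_S(1)[OF v'] hS, of 1 t] B_lin[of "insert j I" r 1 v' t h]
        unfolding v_eq[symmetric] by simp
    qed
    ultimately show ?thesis unfolding B_def by blast
  qed
qed

section \<open>Polynomials and the discrete spaces\<close>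

lemma polynomials_0: "polynomials 0 = range (\<lambda>a (x :: real ^ 'd). a)"
proof -
  have "{\<alpha> :: 'd \<Rightarrow> nat. (\<Sum>i\<in>UNIV. \<alpha> i) \<le> 0} = {\<lambda>_. 0}" by auto
  then show ?thesis by (auto simp: polynomials_def image_iff intro: exI[of _ "\<lambda>_. _"])
qed

lemma sum_le_1_iff:
  "(\<Sum>i\<in>UNIV. \<alpha> i) \<le> 1 \<longleftrightarrow> \<alpha> \<in> insert (\<lambda>_. 0) (range (\<lambda>i j. if j = i then 1 else 0))"
  for \<alpha> :: "'d::finite \<Rightarrow> nat"
proof
  assume le: "(\<Sum>i\<in>UNIV. \<alpha> i) \<le> 1"
  show "\<alpha> \<in> insert (\<lambda>_. 0) (range (\<lambda>i j. if j = i then 1 else 0))"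
  proof (cases "\<forall>i. \<alpha> i = 0")
    case False
    then obtain i where i: "\<alpha> i \<noteq> 0" by blast
    have "(\<Sum>i\<in>UNIV. \<alpha> i) = \<alpha> i + (\<Sum>j\<in>UNIV - {i}. \<alpha> j)" by (simp add: sum.remove)
    then have "\<alpha> i = 1" "(\<Sum>j\<in>UNIV - {i}. \<alpha> j) = 0" using le i by linarith+
    then have "\<alpha> = (\<lambda>j. if j = i then 1 else 0)" by (simp add: fun_eq_iff)
    then show ?thesis by blast
  qed auto
qed (auto simp: sum.delta)

text \<open>Exponents of total degree at most 1 are zero or a unit vector, so only the constant and
  the coordinate monomials occur.\<close>

lemma polynomials_1_affine:
  fixes p :: "real ^ 'd \<Rightarrow> real"
  assumes "p \<in> polynomials 1"
  obtains a b where "p = (\<lambda>x. a + b \<bullet> x)"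
proof -
  let ?e = "\<lambda>i j :: 'd. if j = i then 1 else 0 :: nat"
  obtain c where c: "p = (\<lambda>x. \<Sum>\<alpha>\<in>{\<alpha>. (\<Sum>i\<in>UNIV. \<alpha> i) \<le> 1}. c \<alpha> * (\<Prod>i\<in>UNIV. (x $ i) ^ \<alpha> i))"
    using assms unfolding polynomials_def by blast
  have inj: "inj ?e"
    by (rule injI) (metis zero_neq_one)
  have notin: "(\<lambda>_. 0) \<notin> range ?e"
  proof
    assume "(\<lambda>_. 0) \<in> range ?e"
    then obtain i where "(\<lambda>_. 0) = ?e i" by blast
    from fun_cong[OF this, of i] show False by simp
  qed
  have mono: "(\<Prod>j\<in>UNIV. (x $ j) ^ ?e i j) = x $ i" for x :: "real ^ 'd" and i
  proof -
    have "(\<Prod>j\<in>UNIV. (x $ j) ^ ?e i j) = (\<Prod>j\<in>UNIV. if j = i then x $ j else 1)"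
      by (rule prod.cong) auto
    then show ?thesis by simp
  qed
  have set_eq: "{\<alpha> :: 'd \<Rightarrow> nat. (\<Sum>i\<in>UNIV. \<alpha> i) \<le> 1} = insert (\<lambda>_. 0) (range ?e)"
    using sum_le_1_iff by blast
  have "p x = c (\<lambda>_. 0) + (\<chi> i. c (?e i)) \<bullet> x" for x
    unfolding c set_eq using notin
    by (simp add: sum.reindex[OF inj] o_def mono inner_vec_def)
  then show ?thesis using that by blast
qed

lemma const_in_polynomials: "(\<lambda>_ :: real ^ 'd. a) \<in> polynomials k"
proof -
  let ?c = "\<lambda>\<alpha>. if \<alpha> = (\<lambda>_. 0) then a else 0"
  \<comment> \<open>A sum over an infinite set is 0 by convention, so the constant term can be
    extracted only once the exponent set is known to be finite.\<close>
  have fin: "finite {\<alpha> :: 'd \<Rightarrow> nat. (\<Sum>i\<in>UNIV. \<alpha> i) \<le> k}"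
  proof (rule finite_subset)
    show "{\<alpha> :: 'd \<Rightarrow> nat. (\<Sum>i\<in>UNIV. \<alpha> i) \<le> k} \<subseteq> (\<Pi>\<^sub>E i\<in>UNIV. {..k})"
    proof (intro subsetI PiE_I)
      fix \<alpha> :: "'d \<Rightarrow> nat" and i
      assume "\<alpha> \<in> {\<alpha>. (\<Sum>i\<in>UNIV. \<alpha> i) \<le> k}"
      then show "\<alpha> i \<in> {..k}"
        using member_le_sum[of i UNIV \<alpha>] by simp
    qed simp
    show "finite (\<Pi>\<^sub>E i\<in>(UNIV :: 'd set). {..k})" by (intro finite_PiE) auto
  qed
  have "(\<Sum>\<alpha>\<in>{\<alpha>. (\<Sum>i\<in>UNIV. \<alpha> i) \<le> k}. ?c \<alpha> * (\<Prod>i\<in>UNIV. (x $ i) ^ \<alpha> i)) = a" for x :: "real ^ 'd"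
  proof -
    have "(\<Sum>\<alpha>\<in>{\<alpha>. (\<Sum>i\<in>UNIV. \<alpha> i) \<le> k}. ?c \<alpha> * (\<Prod>i\<in>UNIV. (x $ i) ^ \<alpha> i)) =
          (\<Sum>\<alpha>\<in>{\<alpha> :: 'd \<Rightarrow> nat. (\<Sum>i\<in>UNIV. \<alpha> i) \<le> k}. if \<alpha> = (\<lambda>_. 0) then a else 0)"
      by (rule sum.cong) auto
    then show ?thesis using fin by (simp add: sum.delta)
  qed
  then show ?thesis unfolding polynomials_def by (intro CollectI exI[of _ ?c]) auto
qed

lemma polynomials_linear:
  assumes "p \<in> polynomials k" "q \<in> polynomials k"
  shows "(\<lambda>x. a * p x + b * q x) \<in> polynomials k"
proof -
  obtain c d where "p = (\<lambda>x. \<Sum>\<alpha>\<in>{\<alpha>. (\<Sum>i\<in>UNIV. \<alpha> i) \<le> k}. c \<alpha> * (\<Prod>i\<in>UNIV. (x $ i) ^ \<alpha> i))"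
    "q = (\<lambda>x. \<Sum>\<alpha>\<in>{\<alpha>. (\<Sum>i\<in>UNIV. \<alpha> i) \<le> k}. d \<alpha> * (\<Prod>i\<in>UNIV. (x $ i) ^ \<alpha> i))"
    using assms unfolding polynomials_def by blast
  then have "(\<lambda>x. a * p x + b * q x) =
      (\<lambda>x. \<Sum>\<alpha>\<in>{\<alpha>. (\<Sum>i\<in>UNIV. \<alpha> i) \<le> k}. (a * c \<alpha> + b * d \<alpha>) * (\<Prod>i\<in>UNIV. (x $ i) ^ \<alpha> i))"
    by (simp add: sum_distrib_left algebra_simps flip: sum.distrib)
  then show ?thesis unfolding polynomials_def by (intro CollectI exI)
qed

lemma const_in_P_disc: "(\<lambda>_. a) \<in> P_disc k T"
  using const_in_polynomials[of a k] by (auto simp: P_disc_def)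

lemma const_in_P_cont: "(\<lambda>_. a) \<in> P_cont k T"
  unfolding P_cont_def using const_in_P_disc by simp

lemma P_cont_linear:
  assumes "u \<in> P_cont k T" "v \<in> P_cont k T"
  shows "(\<lambda>x. a * u x + b * v x) \<in> P_cont k T"
proof -
  have "(\<lambda>x. a * u x + b * v x) \<in> P_disc k T"
    unfolding P_disc_def
  proof (intro CollectI ballI)
    fix K assume "K \<in> T"
    then obtain p q where "p \<in> polynomials k" "\<forall>x\<in>interior K. u x = p x"
      "q \<in> polynomials k" "\<forall>x\<in>interior K. v x = q x"
      using assms unfolding P_cont_def P_disc_def by blast
    then show "\<exists>p\<in>polynomials k. \<forall>x\<in>interior K. a * u x + b * v x = p x"
      using polynomials_linear[of p k q a b] by auto
  qed
  moreover have "continuous_on (\<Union>T) (\<lambda>x. a * u x + b * v x)"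
    using assms unfolding P_cont_def by (auto intro!: continuous_intros)
  ultimately show ?thesis unfolding P_cont_def by simp
qed

text \<open>Full dimension makes the interior coincide with the relative interior, which is
  nonempty. This lets information given only on open elements pass to faces and vertices.\<close>

lemma simplex_closure_interior:
  fixes K :: "'a::euclidean_space set"
  assumes "int DIM('a) simplex K"
  shows "convex K" "compact K" "interior K \<noteq> {}" "closure (interior K) = K"
proof -
  show c: "convex K" "compact K"
    using assms convex_simplex compact_simplex by blast+
  show i: "interior K \<noteq> {}"
    using aff_dim_simplex[OF assms] interior_rel_interior_gen[of K] rel_interior_eq_empty[OF c(1)] by auto
  show "closure (interior K) = K"
    using convex_closure_interior[OF c(1) i] c(2) by (simp add: compact_imp_closed)
qed

text \<open>\<open>P_disc\<close> prescribes values only in the open element. Continuity carries the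
  affine formula to its closure, and so to the vertices read by the lumped product.\<close>

lemma P_cont_1_affine_on_simplex:
  fixes v :: "real ^ 'd \<Rightarrow> real"
  assumes v: "v \<in> P_cont 1 T" and K: "K \<in> T" "int CARD('d) simplex K"
  shows "\<exists>a b. \<forall>x\<in>K. v x = a + b \<bullet> x"
proof -
  obtain p where p: "p \<in> polynomials 1" "\<forall>x\<in>interior K. v x = p x"
    using v K(1) unfolding P_cont_def P_disc_def by blast
  obtain a b where ab: "p = (\<lambda>x. a + b \<bullet> x)" using polynomials_1_affine[OF p(1)] .
  have "int DIM(real ^ 'd) simplex K" using K(2) by simp
  note smp = simplex_closure_interior[OF this]
  have cont: "continuous_on K v"
    using v K(1) unfolding P_cont_def by (blast intro: continuous_on_subset)
  have "continuous_on K (\<lambda>x. v x - (a + b \<bullet> x))"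
    by (intro continuous_intros cont)
  then have "v x - (a + b \<bullet> x) = 0" if "x \<in> K" for x
    using continuous_constant_on_closure[of "interior K" "\<lambda>x. v x - (a + b \<bullet> x)" 0 x] smp(4) that p(2) ab
    by auto
  then show ?thesis by auto
qed

text \<open>The simplex is the hull of its extreme points, and the zero set of an affine function is
  convex.\<close>

lemma affine_zero_on_simplex:
  assumes "n simplex K" "\<And>x. x extreme_point_of K \<Longrightarrow> a + b \<bullet> x = (0::real)" "x \<in> K"
  shows "a + b \<bullet> x = 0"
proof -
  have "K = convex hull {x. x extreme_point_of K}"
    using assms(1) Krein_Milman_Minkowski compact_simplex convex_simplex by blast
  also have "\<dots> \<subseteq> {x. b \<bullet> x = - a}"
    using assms(2) by (intro hull_minimal convex_hyperplane) (auto simp: eq_neg_iff_add_eq_0 add.commute)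
  finally show ?thesis using assms(3) by auto
qed

section \<open>Integration over the mesh\<close>

lemma set_integral_Un_negligible:
  fixes f :: "'a::euclidean_space \<Rightarrow> real"
  assumes "S \<in> sets lebesgue" "negligible N" "set_integrable lebesgue S f"
  shows "set_integrable lebesgue (S \<union> N) f" "(LINT x:S \<union> N|lebesgue. f x) = (LINT x:S|lebesgue. f x)"
proof -
  have N: "N \<in> null_sets lebesgue" using assms(2) by (simp add: negligible_iff_null_sets)
  then have Ns: "N \<in> sets lebesgue" by auto
  have fN: "set_integrable lebesgue N f" using absolutely_integrable_negligible[OF assms(2)] .
  show "set_integrable lebesgue (S \<union> N) f" using assms fN Ns by (intro set_integrable_Un)
  have "(LINT x:S \<union> N|lebesgue. f x) = (LINT x:S|lebesgue. f x) + (LINT x:N|lebesgue. f x)"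
    using AE_not_in[OF N] assms fN Ns by (intro set_integral_Un_AE) auto
  moreover have "(LINT x:N|lebesgue. f x) = 0"
    using fN assms(2) by (simp add: set_lebesgue_integral_eq_integral integral_negligible)
  ultimately show "(LINT x:S \<union> N|lebesgue. f x) = (LINT x:S|lebesgue. f x)" by simp
qed

text \<open>If two interiors met, the common face would have full dimension. A proper face has
  smaller dimension, so both simplices would equal their intersection.\<close>

lemma disjoint_interiors_triangulation:
  fixes T :: "'a::euclidean_space set set"
  assumes "triangulation T" "\<And>K. K \<in> T \<Longrightarrow> int DIM('a) simplex K"
  shows "disjoint_family_on interior T"
  unfolding disjoint_family_on_def
proof (intro ballI impI, rule ccontr)
  fix K L assume KL: "K \<in> T" "L \<in> T" "K \<noteq> L" "interior K \<inter> interior L \<noteq> {}"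
  have "aff_dim (K \<inter> L) = DIM('a)"
    using KL(4) by (intro aff_dim_nonempty_interior) simp
  moreover have "(K \<inter> L) face_of K" "(K \<inter> L) face_of L"
    using assms(1) KL(1,2) unfolding triangulation_def by (metis, metis Int_commute)
  moreover have "F = M" if "M \<in> T" "F face_of M" "aff_dim F = DIM('a)" for F M
    using face_of_aff_dim_lt[of M F] that convex_simplex[OF assms(2)[OF that(1)]]
      aff_dim_simplex[OF assms(2)[OF that(1)]] by linarith
  ultimately have "K \<inter> L = K" "K \<inter> L = L" using KL(1,2) by blast+
  then show False using KL(3) by simp
qed

lemma admissible_mesh_simplex:
  fixes T :: "(real ^ 'd) set set"
  assumes "admissible_mesh \<Omega> \<sigma> T"
  shows "finite T" "\<And>K. K \<in> T \<Longrightarrow> int CARD('d) simplex K" "triangulation T" "\<Union>T = closure \<Omega>"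
  using assms by (auto simp: admissible_mesh_def triangulation_def)

text \<open>The open elements are disjoint and miss only points of element frontiers, which are null
  because the elements are convex.\<close>

lemma mesh_integral:
  fixes f :: "real ^ 'd \<Rightarrow> real"
  assumes dom: "polyhedral_domain \<Omega>" and mesh: "admissible_mesh \<Omega> \<sigma> T"
    and f: "\<And>K. K \<in> T \<Longrightarrow> set_integrable lebesgue (interior K) f"
  shows "set_integrable lebesgue \<Omega> f"
    "(LINT x:\<Omega>|lebesgue. f x) = (\<Sum>K\<in>T. LINT x:interior K|lebesgue. f x)"
proof -
  note T = admissible_mesh_simplex[OF mesh]
  have cv: "convex K" "closed K" if "K \<in> T" for K
    using T(2)[OF that] convex_simplex compact_simplex compact_imp_closed by blast+
  let ?G = "\<Union>K\<in>T. interior K"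
  \<comment> \<open>The elements cover only the closure of \<open>\<Omega>\<close>; the open ones
    lie in \<open>\<Omega>\<close> itself because \<open>\<Omega>\<close> is the interior of its
    closure.\<close>
  have "?G \<subseteq> interior (\<Union>T)" by (auto intro: interior_mono[THEN subsetD])
  then have sub: "?G \<subseteq> \<Omega>" using dom T(4) by (simp add: polyhedral_domain_def)
  have "\<Omega> - ?G \<subseteq> (\<Union>K\<in>T. frontier K)"
    using T(4) closure_subset[of \<Omega>] cv(2) by (fastforce simp: frontier_def)
  then have neg: "negligible (\<Omega> - ?G)"
    by (rule negligible_subset[rotated]) (use T(1) cv negligible_convex_frontier in auto)
  have eq: "\<Omega> = ?G \<union> (\<Omega> - ?G)" using sub by blast
  have G: "?G \<in> sets lebesgue" by (intro sets.finite_UN T(1)) auto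
  have fG: "set_integrable lebesgue ?G f"
    using T(1) f by (intro set_integrable_UN) auto
  show "set_integrable lebesgue \<Omega> f"
    by (subst eq) (rule set_integral_Un_negligible[OF G neg fG])
  have "(LINT x:\<Omega>|lebesgue. f x) = (LINT x:?G|lebesgue. f x)"
    by (subst eq) (rule set_integral_Un_negligible[OF G neg fG])
  also have "\<dots> = (\<Sum>K\<in>T. LINT x:interior K|lebesgue. f x)"
    using T f by (intro set_integral_finite_Union disjoint_interiors_triangulation) auto
  finally show "(LINT x:\<Omega>|lebesgue. f x) = (\<Sum>K\<in>T. LINT x:interior K|lebesgue. f x)" .
qed

text \<open>On each open element the product is a constant times a function continuous on the
  compact closed element. Taking one factor to be 1 covers each space separately.\<close>

lemma P_disc_0_P_cont_integrable:
  assumes dom: "polyhedral_domain \<Omega>" and mesh: "admissible_mesh \<Omega> \<sigma> T"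
    and g: "g \<in> P_disc 0 T" and v: "v \<in> P_cont k T"
  shows "set_integrable lebesgue \<Omega> (\<lambda>x. g x * v x)"
proof (rule mesh_integral(1)[OF dom mesh])
  fix K assume K: "K \<in> T"
  obtain c where c: "\<And>x. x \<in> interior K \<Longrightarrow> g x = c"
    using g K unfolding P_disc_def polynomials_0 by fastforce
  have "compact K" using admissible_mesh_simplex(2)[OF mesh K] compact_simplex by blast
  moreover have "continuous_on K v"
    using v K unfolding P_cont_def by (blast intro: continuous_on_subset)
  ultimately have "set_integrable lebesgue K (\<lambda>x. c * v x)"
    by (intro set_integrable_compact continuous_intros)
  then have "set_integrable lebesgue (interior K) (\<lambda>x. c * v x)"
    by (rule set_integrable_subset) (auto simp: interior_subset)
  then show "set_integrable lebesgue (interior K) (\<lambda>x. g x * v x)"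
    by (rule set_integrable_cong[THEN iffD1, rotated -1]) (use c in auto)
qed

lemma P_disc_0_integrable:
  assumes "polyhedral_domain \<Omega>" "admissible_mesh \<Omega> \<sigma> T" "g \<in> P_disc 0 T"
  shows "set_integrable lebesgue \<Omega> g"
  using P_disc_0_P_cont_integrable[OF assms const_in_P_cont[of 1 0]] by simp

lemma P_cont_integrable:
  assumes "polyhedral_domain \<Omega>" "admissible_mesh \<Omega> \<sigma> T" "v \<in> P_cont k T"
  shows "set_integrable lebesgue \<Omega> v"
  using P_disc_0_P_cont_integrable[OF assms(1,2) const_in_P_disc[of 1] assms(3)] by simp

text \<open>Vertex quadrature is exact on each element, where \<open>v\<close> is affine; passing
  between the open and the closed element changes no integral, since the frontier is null.\<close>

lemma integral_P_cont_1_eq_lumped: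
  assumes dom: "polyhedral_domain \<Omega>" and mesh: "admissible_mesh \<Omega> \<sigma> T"
    and v: "v \<in> P_cont 1 T"
  shows "(LINT x:\<Omega>|lebesgue. v x) = lumped_ip T v (\<lambda>_. 1)"
proof -
  have elem: "set_integrable lebesgue (interior K) v \<and>
     (LINT x:interior K|lebesgue. v x) =
       measure lebesgue K / (real CARD('a) + 1) * (\<Sum>x\<in>vertices K. v x)" if K: "K \<in> T" for K
  proof -
    have smp: "int DIM(real ^ 'a) simplex K" using admissible_mesh_simplex(2)[OF mesh K] by simp
    note c = simplex_closure_interior[OF smp]
    obtain a b where ab: "\<And>x. x \<in> K \<Longrightarrow> v x = a + b \<bullet> x"
      using P_cont_1_affine_on_simplex[OF v K admissible_mesh_simplex(2)[OF mesh K]] by blast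
    have "continuous_on K v" using v K unfolding P_cont_def by (blast intro: continuous_on_subset)
    then have "set_integrable lebesgue K v" using c(2) by (intro set_integrable_compact)
    then have int: "set_integrable lebesgue (interior K) v"
      by (rule set_integrable_subset) (auto simp: interior_subset)
    have "K = interior K \<union> frontier K"
      using c(2) interior_subset[of K] by (auto simp: frontier_def compact_imp_closed)
    then have "(LINT x:interior K|lebesgue. v x) = (LINT x:K|lebesgue. v x)"
      using set_integral_Un_negligible(2)[OF _ negligible_convex_frontier[OF c(1)] int] by simp
    also have "\<dots> = (LINT x:K|lebesgue. a + b \<bullet> x)"
      using ab c(2) by (intro set_lebesgue_integral_cong) (auto simp: lmeasurable_compact fmeasurableD)
    also have "\<dots> = measure lebesgue K / (real CARD('a) + 1) * (\<Sum>x\<in>vertices K. v x)"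
      unfolding integral_affine_simplex[OF smp] vertices_def
      by (simp add: ab extreme_point_of_def)
    finally show ?thesis using int by simp
  qed
  show ?thesis
    using mesh_integral(2)[OF dom mesh, of v] elem
    by (simp add: lumped_ip_def sum_distrib_left)
qed

text \<open>\<open>Proj1h\<close> is a choice, so its defining property becomes available only
  through existence. The Riesz lemma applies because the lumped product is a positively weighted sum
  of vertex values and a function in \<open>P_cont 1 T\<close> is determined on
  \<open>\<Omega>\<close> by those values.\<close>

lemma Proj1h_exists:
  fixes T :: "(real ^ 'd) set set"
  assumes dom: "polyhedral_domain \<Omega>" and mesh: "admissible_mesh \<Omega> \<sigma> T"
    and g: "g \<in> P_disc 0 T"
  shows "\<exists>q. q \<in> P_cont 1 T \<and> (\<forall>v\<in>P_cont 1 T. lumped_ip T q v = ip \<Omega> g v)"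
proof -
  note T = admissible_mesh_simplex[OF mesh]
  have smp: "int DIM(real ^ 'd) simplex K" if "K \<in> T" for K using T(2)[OF that] by simp
  note c = simplex_closure_interior[OF smp]
  have finv: "finite (vertices K)" if K: "K \<in> T" for K
  proof -
    obtain C where C: "\<not> affine_dependent C" "K = convex hull C"
      using T(2)[OF K] unfolding simplex_def by blast
    have "vertices K \<subseteq> C"
      using extreme_point_of_convex_hull_affine_independent[OF C(1)] C(2) by (auto simp: vertices_def)
    then show ?thesis using aff_independent_finite[OF C(1)] finite_subset by blast
  qed
  \<comment> \<open>Indexing by pairs of an element and one of its vertices matches the double sum;
    a vertex shared by several elements simply occurs once for each.\<close>
  define I where "I = Sigma T vertices"
  define w where "w i = measure lebesgue (fst i) / (real CARD('d) + 1)" for i :: "(real ^ 'd) set \<times> (real ^ 'd)"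
  have lump: "lumped_ip T q v = (\<Sum>i\<in>I. w i * (q (snd i) * v (snd i)))" for q v
    using T(1) finv unfolding lumped_ip_def I_def w_def
    by (simp add: sum_distrib_left sum.Sigma split_def)
  \<comment> \<open>A simplex with nonempty interior has positive volume.\<close>
  have w_pos: "0 < w i" if "i \<in> I" for i
  proof -
    have K: "fst i \<in> T" using that by (auto simp: I_def)
    then have "\<not> negligible (fst i)"
      using c(3)[OF K] open_not_negligible negligible_subset interior_subset open_interior by blast
    then have "measure lebesgue (fst i) \<noteq> 0"
      using c(2)[OF K] by (simp add: negligible_iff_measure0 lmeasurable_compact)
    then show ?thesis by (simp add: w_def zero_less_measure_iff)
  qed
  have int: "set_integrable lebesgue \<Omega> (\<lambda>x. g x * v x)" if "v \<in> P_cont 1 T" for v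
    using P_disc_0_P_cont_integrable[OF dom mesh g that] .
  have ip_lin: "ip \<Omega> g (\<lambda>x. a * u x + b * v x) = a * ip \<Omega> g u + b * ip \<Omega> g v"
    if "u \<in> P_cont 1 T" "v \<in> P_cont 1 T" for u v a b
  proof -
    have "ip \<Omega> g (\<lambda>x. a * u x + b * v x) = (LINT x:\<Omega>|lebesgue. a * (g x * u x) + b * (g x * v x))"
      by (simp add: ip_def algebra_simps)
    also have "\<dots> = a * ip \<Omega> g u + b * ip \<Omega> g v"
      using int that by (simp add: ip_def set_integral_add set_integrable_mult_right)
    finally show ?thesis .
  qed
  have ip_0: "ip \<Omega> g v = 0" if v: "v \<in> P_cont 1 T" and v0: "\<And>i. i \<in> I \<Longrightarrow> v (snd i) = 0" for v
  proof -
    have "v x = 0" if x: "x \<in> \<Omega>" for x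
    proof -
      obtain K where K: "K \<in> T" "x \<in> K" using x T(4) closure_subset by blast
      obtain a b where ab: "\<And>y. y \<in> K \<Longrightarrow> v y = a + b \<bullet> y"
        using P_cont_1_affine_on_simplex[OF v K(1) T(2)[OF K(1)]] by blast
      have "a + b \<bullet> y = 0" if "y extreme_point_of K" for y
        using v0[of "(K, y)"] K(1) that ab[of y]
        by (auto simp: I_def vertices_def extreme_point_of_def)
      then show ?thesis using affine_zero_on_simplex[OF T(2)[OF K(1)] _ K(2)] ab[OF K(2)] by simp
    qed
    then have "(\<lambda>x. indicator \<Omega> x *\<^sub>R (g x \<bullet> v x)) = (\<lambda>_. 0)" by (auto simp: indicator_def)
    then show ?thesis unfolding ip_def set_lebesgue_integral_def by simp
  qed
  have "\<exists>q\<in>P_cont 1 T. \<forall>v\<in>P_cont 1 T. (\<Sum>i\<in>I. w i * (q (snd i) * v (snd i))) = ip \<Omega> g v"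
  proof (rule weighted_Riesz)
    show "finite I" unfolding I_def using T(1) finv by blast
    show "P_cont 1 T \<noteq> {}" using const_in_P_cont by blast
  qed (use P_cont_linear w_pos ip_lin ip_0 in auto)
  then show ?thesis unfolding lump by blast
qed

text \<open>Testing the projection with 1 equates its lumped mass with the mass of \<open>g\<close>,
  and quadrature turns the lumped mass into an integral.\<close>

lemma
  assumes "polyhedral_domain \<Omega>" "admissible_mesh \<Omega> \<sigma> T" "g \<in> P_disc 0 T"
  shows Proj1h_in_P_cont: "Proj1h \<Omega> T g \<in> P_cont 1 T"
    and integral_Proj1h: "(LINT x:\<Omega>|lebesgue. Proj1h \<Omega> T g x) = (LINT x:\<Omega>|lebesgue. g x)"
proof -
  have P: "Proj1h \<Omega> T g \<in> P_cont 1 T" "\<forall>v\<in>P_cont 1 T. lumped_ip T (Proj1h \<Omega> T g) v = ip \<Omega> g v"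
    unfolding Proj1h_def using someI_ex[OF Proj1h_exists[OF assms]] by blast+
  show "Proj1h \<Omega> T g \<in> P_cont 1 T" by fact
  show "(LINT x:\<Omega>|lebesgue. Proj1h \<Omega> T g x) = (LINT x:\<Omega>|lebesgue. g x)"
    using integral_P_cont_1_eq_lumped[OF assms(1,2) P(1)] P(2) const_in_P_cont[of 1 1 T]
    by (simp add: ip_def)
qed

section \<open>Faces and conservation of mass\<close>

text \<open>The integrand on the prism is evaluated at the orthogonal projection back to the face
  plane. For a prism point this is its foot in \<open>e\<close>, where \<open>g\<close>
  vanishes.\<close>

lemma face_integral_eq_0:
  assumes \<nu>: "norm \<nu> = 1" and orth: "\<And>x y. x \<in> e \<Longrightarrow> y \<in> e \<Longrightarrow> \<nu> \<bullet> (x - y) = 0"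
    and g: "\<And>x. x \<in> e \<Longrightarrow> g x = 0"
  shows "face_integral \<nu> e g = 0"
proof -
  define z where "z = (SOME z. z \<in> e)"
  define P where "P = {x + t *\<^sub>R \<nu> | x t. x \<in> e \<and> 0 \<le> t \<and> t \<le> 1}"
  have "g (y - ((y - z) \<bullet> \<nu>) *\<^sub>R \<nu>) = 0" if y: "y \<in> P" for y
  proof -
    obtain x t where xt: "x \<in> e" "y = x + t *\<^sub>R \<nu>" using y by (auto simp: P_def)
    \<comment> \<open>The choice of \<open>z\<close> is meaningful because a prism point exhibits a
      point of \<open>e\<close>.\<close>
    then have "z \<in> e" unfolding z_def by (metis someI)
    then have "(y - z) \<bullet> \<nu> = t"
      using orth[of x z] xt \<nu>
      by (simp add: inner_commute[of _ \<nu>] inner_diff_right inner_add_right dot_square_norm)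
    then show ?thesis using xt g by simp
  qed
  then have "(\<lambda>y. indicator P y *\<^sub>R g (y - ((y - z) \<bullet> \<nu>) *\<^sub>R \<nu>)) = (\<lambda>_. 0)"
    by (auto simp: indicator_def)
  then show ?thesis
    unfolding face_integral_def Let_def z_def[symmetric] P_def[symmetric] set_lebesgue_integral_def
    by simp
qed

text \<open>\<open>Lim\<close> is determined only along a nontrivial filter; a point of the closure
  of an open set is a limit point of it.\<close>

lemma trace_from_const:
  assumes "x \<in> closure (interior K)"
  shows "trace_from K (\<lambda>_. a) x = a"
proof -
  have "x islimpt interior K"
    using assms interior_limit_point[of x "interior K"] by (auto simp: closure_def)
  then show ?thesis
    unfolding trace_from_def by (intro tendsto_Lim tendsto_const) (simp add: trivial_limit_within)
qed

text \<open>Points of the common face lie in the closures of both open elements, so both traces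
  equal \<open>a\<close> and cancel. The factor \<open>h\<close> is arbitrary so that the integrands
  of both upwind forms are covered.\<close>

lemma face_integral_jump_const:
  fixes T :: "(real ^ 'd) set set"
  assumes mesh: "admissible_mesh \<Omega> \<sigma> T" "face_normals T n" and KL: "(K, L) \<in> oriented_faces T n"
  shows "face_integral (n (K \<inter> L)) (K \<inter> L) (\<lambda>x. h x * jump K L (\<lambda>_. a) x) = 0"
proof (rule face_integral_eq_0)
  have nb: "neighbours T K L" using KL by (simp add: oriented_faces_def)
  then have "K \<inter> L \<in> interior_faces T" by (auto simp: interior_faces_def)
  then show "norm (n (K \<inter> L)) = 1"
    "\<And>x y. x \<in> K \<inter> L \<Longrightarrow> y \<in> K \<inter> L \<Longrightarrow> n (K \<inter> L) \<bullet> (x - y) = 0"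
    using mesh(2) unfolding face_normals_def by blast+
  fix x assume x: "x \<in> K \<inter> L"
  have "K \<in> T" "L \<in> T" using nb by (auto simp: neighbours_def)
  then have "int DIM(real ^ 'd) simplex K" "int DIM(real ^ 'd) simplex L"
    using admissible_mesh_simplex(2)[OF mesh(1)] by auto
  then have "closure (interior K) = K" "closure (interior L) = L"
    using simplex_closure_interior(4) by blast+
  then show "h x * jump K L (\<lambda>_. a) x = 0" using x by (simp add: jump_def trace_from_const)
qed

lemma
  assumes "admissible_mesh \<Omega> \<sigma> T" "face_normals T n"
  shows a_upw_const: "a_upw T n u \<phi> (\<lambda>_. a) = 0"
    and b_upw_const: "b_upw \<Omega> T n \<mu> \<phi> (\<lambda>_. a) = 0"
  unfolding a_upw_def b_upw_def
  by (auto intro!: sum.neutral simp: face_integral_jump_const[OF assms])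

text \<open>The density is affine in the phase field, so its integral depends on
  \<open>\<phi>\<close> only through the mass.\<close>

lemma integral_mix_density:
  assumes "polyhedral_domain \<Omega>" "admissible_mesh \<Omega> \<sigma> T" "set_integrable lebesgue \<Omega> \<phi>"
  shows "(LINT x:\<Omega>|lebesgue. mix_density \<rho>1 \<rho>2 (\<phi> x)) =
    (LINT x:\<Omega>|lebesgue. rho_avg \<rho>1 \<rho>2) + rho_dif \<rho>1 \<rho>2 * (LINT x:\<Omega>|lebesgue. \<phi> x)"
  using assms(3) P_disc_0_integrable[OF assms(1,2) const_in_P_disc]
  by (simp add: mix_density_def set_integral_add set_integrable_mult_right)

theorem proposition3p4:
  fixes \<Omega> :: "(real ^ 'd) set"
    and T :: "(real ^ 'd) set set"
    and n :: "(real ^ 'd) set \<Rightarrow> real ^ 'd"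
    and Uh :: "(real ^ 'd \<Rightarrow> real ^ 'd) set"
    and Ph :: "(real ^ 'd \<Rightarrow> real) set"
    and \<rho>1 \<rho>2 lam \<epsilon> \<Delta>t \<sigma> \<beta> C :: real
    and \<eta> :: "real \<Rightarrow> real"
    and u0 u1 :: "real ^ 'd \<Rightarrow> real ^ 'd"
    and \<phi>0 \<phi>1 \<mu>0 \<mu>1 p1 :: "real ^ 'd \<Rightarrow> real"
  assumes dim: "CARD('d) \<in> {2, 3}"
    and domain: "polyhedral_domain \<Omega>"
    and mesh: "admissible_mesh \<Omega> \<sigma> T" "face_normals T n"
    and spaces: "velocity_pressure_pair \<Omega> T \<beta> Uh Ph"
    and constants: "0 < \<rho>1" "\<rho>1 < \<rho>2" "0 < lam" "0 < \<epsilon>" "0 < \<Delta>t"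
    and viscosity: "continuous_on {-1..1} \<eta>" "0 < C" "\<And>s. s \<in> {-1..1} \<Longrightarrow> C \<le> \<eta> s"
    and data: "u0 \<in> Uh" "\<phi>0 \<in> P_disc 0 T" "\<mu>0 \<in> P_cont 1 T"
      "\<And>K x. K \<in> T \<Longrightarrow> x \<in> interior K \<Longrightarrow> \<phi>0 x \<in> {-1..1}"
    and unknowns: "u1 \<in> Uh" "p1 \<in> Ph" "(LINT x:\<Omega>|lebesgue. p1 x) = 0"
      "\<phi>1 \<in> P_disc 0 T" "\<mu>1 \<in> P_cont 1 T"
    and S1: "eq_S1 \<Omega> T n Uh \<rho>1 \<rho>2 \<Delta>t \<eta> u0 \<phi>0 \<mu>0 u1 p1 \<phi>1 \<mu>1"
    and S2: "eq_S2 \<Omega> T Ph u1"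
    and S3: "eq_S3 \<Omega> T n \<Delta>t \<phi>0 u1 \<phi>1 \<mu>1"
    and S4: "eq_S4 \<Omega> T lam \<epsilon> \<phi>0 \<phi>1 \<mu>1"
  shows "(LINT x:\<Omega>|lebesgue. \<phi>1 x) = (LINT x:\<Omega>|lebesgue. \<phi>0 x) \<and>
         (LINT x:\<Omega>|lebesgue. Proj1h \<Omega> T \<phi>1 x) = (LINT x:\<Omega>|lebesgue. Proj1h \<Omega> T \<phi>0 x) \<and>
         (LINT x:\<Omega>|lebesgue. mix_density \<rho>1 \<rho>2 (\<phi>1 x)) = (LINT x:\<Omega>|lebesgue. mix_density \<rho>1 \<rho>2 (\<phi>0 x)) \<and>
         (LINT x:\<Omega>|lebesgue. mix_density \<rho>1 \<rho>2 (Proj1h \<Omega> T \<phi>1 x)) =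
           (LINT x:\<Omega>|lebesgue. mix_density \<rho>1 \<rho>2 (Proj1h \<Omega> T \<phi>0 x))"
proof -
  note dm = domain mesh(1)
  note int0 = P_disc_0_integrable[OF dm data(2)] and int1 = P_disc_0_integrable[OF dm unknowns(4)]
  \<comment> \<open>With the test function 1 in \<open>eq_S3\<close>, only the discrete time
    derivative survives.\<close>
  have "ip \<Omega> (\<lambda>x. (\<phi>1 x - \<phi>0 x) / \<Delta>t) (\<lambda>_. 1) = 0"
    using S3 const_in_P_disc[of 1 0 T]
    by (auto simp: eq_S3_def a_upw_const[OF mesh] b_upw_const[OF mesh])
  then have "((LINT x:\<Omega>|lebesgue. \<phi>1 x) - (LINT x:\<Omega>|lebesgue. \<phi>0 x)) / \<Delta>t = 0"
    using int0 int1 by (simp add: ip_def set_integral_diff)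
  then have mass: "(LINT x:\<Omega>|lebesgue. \<phi>1 x) = (LINT x:\<Omega>|lebesgue. \<phi>0 x)"
    using constants(5) by simp
  have mass_h: "(LINT x:\<Omega>|lebesgue. Proj1h \<Omega> T \<phi>1 x) = (LINT x:\<Omega>|lebesgue. Proj1h \<Omega> T \<phi>0 x)"
    using mass integral_Proj1h[OF dm] data(2) unknowns(4) by simp
  note int_h = P_cont_integrable[OF dm Proj1h_in_P_cont[OF dm]]
  show ?thesis
    using mass mass_h int0 int1 int_h[OF data(2)] int_h[OF unknowns(4)]
    by (simp add: integral_mix_density[OF dm])
qed

end
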